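(* There is a polynomial-time algorithm that, given a graph $G$ and a nonempty set $S\subseteq V(G)$ such that $G-S$ is a clique, outputs an induced subgraph $G'$ of $G$ on at most $3|S|$ vertices such that, for every positive integer $r$, $G$ has a cycle cover of size at most $r$ if and only if $G'$ has a cycle cover of size at most $r$.
   Context: A cycle cover of a graph $G$ is a set of pairwise vertex-disjoint cycles of $G$ such that every vertex of $G$ lies in exactly one of these cycles, where a single vertex is considered a (trivial) cycle; every nontrivial cycle has at least three vertices. The size of a cycle cover is its number of cycles. *)

theory Defs
  imports "Graph_Theory.Graph_Theory" "HOL-Computational_Algebra.Polynomial"
begin

section \<open>Cycle covers\<close>

text \<open>
  A finite simple undirected graph is a finite symmetric digraph without loops and parallel arcs
  (locales \<^locale>\<open>graph\<close> and \<^locale>\<open>pair_graph\<close>).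

  A cycle is given by the list of its vertices in cyclic order. Lists that differ by rotation or
  reversal describe the same cycle, but they have the same vertex set, so two of them never occur
  together in a family of pairwise disjoint cycles. Hence the cardinality of a cycle cover, taken
  as a set of lists, is its number of cycles.
\<close>

definition cycle_verts :: "('a, 'b) pre_digraph \<Rightarrow> 'a list \<Rightarrow> bool" where
  "cycle_verts G c \<longleftrightarrow>
     vpath c G \<and> (length c = 1 \<or> 3 \<le> length c \<and> (last c, hd c) \<in> arcs_ends G)"

definition cycle_cover :: "('a, 'b) pre_digraph \<Rightarrow> 'a list set \<Rightarrow> bool" where
  "cycle_cover G C \<longleftrightarrow>
     (\<forall>c\<in>C. cycle_verts G c) \<and>
     pairwise (\<lambda>c d. set c \<inter> set d = {}) C \<and>
     (\<forall>v\<in>verts G. \<exists>!c. c \<in> C \<and> v \<in> set c)"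

definition has_cycle_cover_of_size_le :: "('a, 'b) pre_digraph \<Rightarrow> nat \<Rightarrow> bool" where
  "has_cycle_cover_of_size_le G r \<longleftrightarrow> (\<exists>C. cycle_cover G C \<and> finite C \<and> card C \<le> r)"

section \<open>Algorithms and running time\<close>

text \<open>
  Algorithms are structured programs for a random access machine. The memory consists of
  arrays of natural numbers, selected by name; a scalar variable is a cell with index 0.
  The only arithmetic is addition and truncated subtraction. There is no multiplication, so the
  bit length of the numbers computed grows at most linearly with the number of steps and
  charging one unit per instruction yields the usual notion of polynomial time. An expression
  has constant size in a fixed program, so evaluating it is part of the instruction that
  contains it.
\<close>

type_synonym vname = string
type_synonym store = "vname \<Rightarrow> nat \<Rightarrow> nat"

datatype aexp = N nat | Get vname aexp | Plus aexp aexp | Minus aexp aexp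

datatype bexp = Bc bool | Less aexp aexp | Eq aexp aexp | Not bexp | And bexp bexp

datatype com =
    Skip
  | Assign vname aexp aexp
  | Seq com com
  | If bexp com com
  | While bexp com

primrec aval :: "aexp \<Rightarrow> store \<Rightarrow> nat" where
  "aval (N k) s = k"
| "aval (Get x a) s = s x (aval a s)"
| "aval (Plus a b) s = aval a s + aval b s"
| "aval (Minus a b) s = aval a s - aval b s"

primrec bval :: "bexp \<Rightarrow> store \<Rightarrow> bool" where
  "bval (Bc v) s = v"
| "bval (Less a b) s = (aval a s < aval b s)"
| "bval (Eq a b) s = (aval a s = aval b s)"
| "bval (Not b) s = (\<not> bval b s)"
| "bval (And b1 b2) s = (bval b1 s \<and> bval b2 s)"

text \<open>
  \<open>exec c s t s'\<close>: program \<open>c\<close> started in \<open>s\<close> terminates in \<open>s'\<close> after \<open>t\<close> steps;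
  \<open>Assign x a b\<close> stands for \<open>x[a] := b\<close>.
\<close>

inductive exec :: "com \<Rightarrow> store \<Rightarrow> nat \<Rightarrow> store \<Rightarrow> bool" where
  Skip: "exec Skip s 1 s"
| Assign: "exec (Assign x a b) s 1 (s(x := (s x)(aval a s := aval b s)))"
| Seq: "exec c1 s t1 s1 \<Longrightarrow> exec c2 s1 t2 s2 \<Longrightarrow> exec (Seq c1 c2) s (t1 + t2) s2"
| IfTrue: "bval b s \<Longrightarrow> exec c1 s t s' \<Longrightarrow> exec (If b c1 c2) s (t + 1) s'"
| IfFalse: "\<not> bval b s \<Longrightarrow> exec c2 s t s' \<Longrightarrow> exec (If b c1 c2) s (t + 1) s'"
| WhileFalse: "\<not> bval b s \<Longrightarrow> exec (While b c) s 1 s"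
| WhileTrue: "bval b s \<Longrightarrow> exec c s t1 s1 \<Longrightarrow> exec (While b c) s1 t2 s2 \<Longrightarrow>
    exec (While b c) s (t1 + t2 + 1) s2"

inductive_cases SkipE: "exec Skip s t s'"
inductive_cases AssignE: "exec (Assign x a b) s t s'"
inductive_cases SeqE: "exec (Seq c1 c2) s t s'"
inductive_cases IfE: "exec (If b c1 c2) s t s'"
inductive_cases WhileE: "exec (While b c) s t s'"

lemma exec_deterministic:
  "exec c s t s' \<Longrightarrow> exec c s u s'' \<Longrightarrow> u = t \<and> s'' = s'"
proof (induction arbitrary: u s'' rule: exec.induct)
  case (Skip s)
  then show ?case by (rule SkipE) simp
next
  case (Assign x a b s)
  then show ?case by (rule AssignE) simp
next
  case (Seq c1 s t1 s1 c2 t2 s2)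
  from Seq.prems show ?case
  proof (rule SeqE)
    fix u1 r u2
    assume u: "u = u1 + u2" and 1: "exec c1 s u1 r" and 2: "exec c2 r u2 s''"
    from Seq.IH(1)[OF 1] have "u1 = t1" "r = s1" by simp_all
    with Seq.IH(2)[of u2 s''] 2 u show ?thesis by simp
  qed
next
  case (IfTrue b s c1 t s' c2)
  from IfTrue.prems show ?case
  proof (rule IfE)
    fix u' assume "u = Suc u'" "exec c1 s u' s''"
    with IfTrue.IH[of u' s''] show ?thesis by simp
  qed (use IfTrue.hyps in simp)
next
  case (IfFalse b s c2 t s' c1)
  from IfFalse.prems show ?case
  proof (rule IfE)
    fix u' assume "u = Suc u'" "exec c2 s u' s''"
    with IfFalse.IH[of u' s''] show ?thesis by simp
  qed (use IfFalse.hyps in simp)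
next
  case (WhileFalse b s c)
  from WhileFalse.prems show ?case
  proof (rule WhileE)
    assume "u = Suc 0" "s'' = s"
    then show ?thesis by simp
  qed (use WhileFalse.hyps in simp)
next
  case (WhileTrue b s c t1 s1 t2 s2)
  from WhileTrue.prems show ?case
  proof (rule WhileE)
    fix u1 r u2
    assume u: "u = Suc (u1 + u2)" and 1: "exec c s u1 r" and 2: "exec (While b c) r u2 s''"
    from WhileTrue.IH(1)[OF 1] have "u1 = t1" "r = s1" by simp_all
    with WhileTrue.IH(2)[of u2 s''] 2 u show ?thesis by simp
  qed (use WhileTrue.hyps in simp)
qed

section \<open>Encoding of instances and results\<close>

text \<open>
  Graphs are presented by adjacency matrices, stored row by row. An input graph has the vertices
  \<open>0, \<dots>, n - 1\<close>; the set \<open>S\<close> is given by its characteristic array. The program leaves its result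
  in \<open>outV\<close> (characteristic array of the vertex set) and \<open>outE\<close> (an \<open>n \<times> n\<close> adjacency
  matrix). As the result is meant to be a subgraph, it keeps the vertex names of the input.
\<close>

definition input_store :: "nat \<Rightarrow> nat pair_pre_digraph \<Rightarrow> nat set \<Rightarrow> store" where
  "input_store n G S = (\<lambda>_ _. 0)
     (''n'' := (\<lambda>i. if i = 0 then n else 0),
      ''S'' := (\<lambda>i. if i \<in> S then 1 else 0),
      ''E'' := (\<lambda>k. if \<exists>u<n. \<exists>v<n. k = u * n + v \<and> (u, v) \<in> parcs G then 1 else 0))"

definition output_graph :: "nat \<Rightarrow> store \<Rightarrow> nat pair_pre_digraph" where
  "output_graph n s =
     \<lparr> pverts = {v. v < n \<and> s ''outV'' v \<noteq> 0},
       parcs = {(u, v). u < n \<and> v < n \<and> s ''outE'' (u * n + v) \<noteq> 0} \<rparr>"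

end

theory Submission
  imports Defs "HOL-Library.Disjoint_Sets"
begin

text \<open>
  Let \<open>C\<close> be the clique \<open>V - S\<close>. The algorithm sells clique vertices to the vertices of \<open>S\<close>, at
  most two to each, in an ascending auction. If no clique vertex has the final price \<open>j\<close>, then the
  set \<open>A\<close> of clique vertices cheaper than \<open>j\<close> has the property of a crown: every vertex of \<open>S\<close> with
  a neighbour in \<open>A\<close> owns two neighbours in \<open>A\<close>, and all clique vertices outside \<open>A\<close> are owned.
  The kernel consists of \<open>S\<close>, the owned clique vertices and some further clique vertices.

  Paths whose ends lie in \<open>C\<close> can be concatenated. Hence in a cycle cover all cycles that contain an
  edge of the clique, or are a single clique vertex, can be merged into one cycle, into which further
  clique vertices can be inserted. Conversely, cutting the cycles that meet \<open>A\<close> at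
  their vertices in \<open>A\<close> leaves pieces that can be prolonged into such paths by owned vertices, so that
  vertices which are not owned are dispensable. The only obstacle is that two vertices do not form a
  cycle; it affects only \<open>card S \<le> 2\<close> and determines the choice of the kernel size there.
\<close>

section \<open>Cycle covers of a graph with a clique\<close>

lemma not_successively_split:
  "\<not> successively R xs \<Longrightarrow> \<exists>as u v bs. xs = as @ u # v # bs \<and> \<not> R u v"
proof (induction R xs rule: successively.induct)
  case (3 P x y xs)
  then show ?case
    by (cases "P x y") (fastforce intro: exI[of _ "x # _"], metis append_Nil)
qed auto

text \<open>Each element satisfying \<open>P\<close> is immediately followed by one that does not,
  and different elements have different successors.\<close>

lemma length_filter_le_filter_not:
  assumes "successively (\<lambda>u v. \<not> (P u \<and> P v)) zs" "zs \<noteq> [] \<Longrightarrow> \<not> P (last zs)"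
  shows "length (filter P zs) \<le> length (filter (\<lambda>z. \<not> P z) zs)"
  using assms
proof (induction zs rule: induct_list012)
  case (3 x y zs)
  show ?case
  proof (cases "P x")
    case True
    with "3.prems" have "\<not> P y" by auto
    moreover have "length (filter P zs) \<le> length (filter (\<lambda>z. \<not> P z) zs)"
      using "3.prems" by (intro "3.IH"(1)) (auto simp: successively_Cons split: if_splits)
    ultimately show ?thesis using True by simp
  next
    case False
    have "length (filter P (y # zs)) \<le> length (filter (\<lambda>z. \<not> P z) (y # zs))"
      using "3.prems" by (intro "3.IH"(2)) auto
    then show ?thesis using False by simp
  qed
qed auto

locale clique_split =
  fixes E :: "'a \<Rightarrow> 'a \<Rightarrow> bool" and S C :: "'a set"
  assumes E_sym: "E u v \<Longrightarrow> E v u"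
    and finite_S: "finite S" and finite_C: "finite C"
    and disjoint: "S \<inter> C = {}"
    and clique: "u \<in> C \<Longrightarrow> v \<in> C \<Longrightarrow> u \<noteq> v \<Longrightarrow> E u v"
begin

text \<open>A cover is determined up to the choice of cyclic orders by the vertex sets of its
  cycles, so only these are kept.\<close>

definition cyc :: "'a set \<Rightarrow> bool" where
  "cyc X \<longleftrightarrow> (\<exists>c. set c = X \<and> distinct c \<and> successively E c \<and>
     (length c = 1 \<or> 3 \<le> length c \<and> E (last c) (hd c)))"

definition linkable :: "'a set \<Rightarrow> bool" where
  "linkable X \<longleftrightarrow> X = {} \<or> (\<exists>p. p \<noteq> [] \<and> set p = X \<and> distinct p \<and> successively E p \<and>
     hd p \<in> C \<and> last p \<in> C)"

lemma cyc_finite: "cyc X \<Longrightarrow> finite X"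
  by (auto simp: cyc_def)

lemma cyc_nonempty: "cyc X \<Longrightarrow> X \<noteq> {}"
  by (auto simp: cyc_def)

lemma cyc_card: "cyc X \<Longrightarrow> card X = 1 \<or> 3 \<le> card X"
  by (auto simp: cyc_def distinct_card)

text \<open>Repeating \<open>x\<close> at the end turns the closing edge into an ordinary
  consecutive pair, so that the cycle can be cut open at any chosen vertex.\<close>

lemma cyc_rotate:
  assumes "cyc X" "3 \<le> card X" "x \<in> X"
  obtains ys where "set (x # ys) = X" "distinct (x # ys)" "successively E (x # ys @ [x])"
proof -
  from assms obtain c where c: "set c = X" "distinct c" "successively E c" "3 \<le> length c"
      "E (last c) (hd c)"
    unfolding cyc_def by (auto simp: distinct_card)
  from assms c obtain us vs where eq: "c = us @ x # vs" by (meson split_list)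
  show ?thesis
    using c that[of "vs @ us"]
    by (cases us; cases vs rule: rev_cases)
      (auto simp: eq successively_append_iff successively_Cons hd_append split: if_splits)
qed

lemma linkable_empty [simp]: "linkable {}"
  by (simp add: linkable_def)

text \<open>The last vertex of one path and the first of the other are distinct clique vertices,
  hence adjacent.\<close>

lemma linkable_Un:
  assumes "linkable X" "linkable Y" "X \<inter> Y = {}"
  shows "linkable (X \<union> Y)"
proof (cases "X = {} \<or> Y = {}")
  case False
  with assms obtain p q where p: "p \<noteq> []" "set p = X" "distinct p" "successively E p"
      "hd p \<in> C" "last p \<in> C"
    and q: "q \<noteq> []" "set q = Y" "distinct q" "successively E q" "hd q \<in> C" "last q \<in> C"
    by (auto simp: linkable_def)
  have "last p \<in> X" "hd q \<in> Y" using p q by auto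
  then have "last p \<noteq> hd q" using assms by auto
  then have "successively E (p @ q)"
    using p q by (auto simp: successively_append_iff intro: clique)
  then show ?thesis using p q assms(3)
    unfolding linkable_def by (intro disjI2 exI[of _ "p @ q"]) auto
qed (use assms in auto)

lemma linkable_UN:
  assumes "finite I" "\<And>i. i \<in> I \<Longrightarrow> linkable (F i)"
    "\<And>i j. i \<in> I \<Longrightarrow> j \<in> I \<Longrightarrow> i \<noteq> j \<Longrightarrow> F i \<inter> F j = {}"
  shows "linkable (\<Union>i\<in>I. F i)"
  using assms
proof (induction I rule: finite_induct)
  case (insert i I)
  then have "linkable (F i \<union> (\<Union>i\<in>I. F i))" by (intro linkable_Un) auto
  then show ?case by simp
qed simp

lemma linkable_singleton: "c \<in> C \<Longrightarrow> linkable {c}"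
  unfolding linkable_def by (intro disjI2 exI[of _ "[c]"]) auto

lemma linkable_clique: "X \<subseteq> C \<Longrightarrow> linkable X"
  using linkable_UN[of X "\<lambda>x. {x}"] finite_subset[OF _ finite_C]
  by (auto intro: linkable_singleton)

text \<open>The surplus clique vertices form a further path, which is appended. This is how one
  cycle absorbs everything left over.\<close>

lemma linkable_superset:
  assumes "linkable X" "X \<subseteq> Y" "Y - X \<subseteq> C"
  shows "linkable Y"
  using linkable_Un[OF assms(1) linkable_clique[OF assms(3)]] assms(2)
  by (simp add: Un_absorb1)

lemma linkable_finite: "linkable X \<Longrightarrow> finite X"
  by (auto simp: linkable_def)

text \<open>From three vertices on, the ends of the path are distinct clique vertices, and their
  edge closes it.\<close>

lemma linkable_cyc:
  assumes "linkable X" "card X = 1 \<or> 3 \<le> card X"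
  shows "cyc X"
proof -
  from assms obtain p where p: "p \<noteq> []" "set p = X" "distinct p" "successively E p"
      "hd p \<in> C" "last p \<in> C"
    by (auto simp: linkable_def)
  have len: "length p = card X" using p distinct_card by metis
  show ?thesis
  proof (cases "length p = 1")
    case True
    then show ?thesis using p unfolding cyc_def by blast
  next
    case False
    then have "3 \<le> length p" using assms(2) len by simp
    moreover from this have "last p \<noteq> hd p" using p(1,3)
      by (cases p) (auto split: if_splits)
    ultimately show ?thesis using p unfolding cyc_def by (blast intro: clique)
  qed
qed

text \<open>In a cycle that is not linkable no two clique vertices are consecutive.\<close>

lemma card_clique_le:
  assumes X: "cyc X" "\<not> linkable X" "X \<subseteq> S \<union> C"
  shows "card (X \<inter> C) \<le> card (X \<inter> S)"
proof (cases "card X = 1")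
  case True
  then obtain v where v: "X = {v}" by (auto simp: card_1_singleton_iff)
  with X have "v \<notin> C" using linkable_singleton by auto
  then show ?thesis using v by auto
next
  case False
  then have card: "3 \<le> card X" using cyc_card X by blast
  obtain x where x: "x \<in> X" "x \<notin> C" using X linkable_clique by blast
  obtain ys where ys: "set (x # ys) = X" "distinct (x # ys)" "successively E (x # ys @ [x])"
    using cyc_rotate[OF X(1) card x(1)] .
  \<comment> \<open>The list ends in \<open>x\<close>, which is outside \<open>C\<close>, so every
    clique vertex in it has a successor, as the counting lemma demands.\<close>
  define zs where "zs = ys @ [x]"
  have zs: "set zs = X" "distinct zs" "successively E zs" "zs \<noteq> []" "E (last zs) (hd zs)"
    using ys by (auto simp: zs_def successively_Cons hd_append)
  have "successively (\<lambda>u v. \<not> (u \<in> C \<and> v \<in> C)) zs"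
  proof (rule ccontr)
    assume "\<not> ?thesis"
    then obtain as u v bs where eq: "zs = as @ u # v # bs" and C: "u \<in> C" "v \<in> C"
      using not_successively_split by fastforce
    \<comment> \<open>Cutting the cycle at the clique edge between \<open>u\<close> and
      \<open>v\<close> leaves a path from \<open>v\<close> to \<open>u\<close>, with both ends in
      \<open>C\<close>.\<close>
    have "successively E ((v # bs) @ (as @ [u]))"
      using zs by (cases as; cases bs rule: rev_cases)
        (auto simp: eq successively_append_iff successively_Cons hd_append split: if_splits)
    then have "linkable X"
      using zs C unfolding linkable_def
      by (intro disjI2 exI[of _ "(v # bs) @ (as @ [u])"]) (auto simp: eq)
    then show False using X by simp
  qed
  then have "length (filter (\<lambda>z. z \<in> C) zs) \<le> length (filter (\<lambda>z. z \<notin> C) zs)"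
    using x by (intro length_filter_le_filter_not) (auto simp: zs_def)
  moreover have "length (filter (\<lambda>z. z \<in> C) zs) = card (X \<inter> C)"
    using zs distinct_card[of "filter (\<lambda>z. z \<in> C) zs"] by (simp add: Int_def)
  moreover have "length (filter (\<lambda>z. z \<notin> C) zs) = card (X \<inter> S)"
  proof -
    have "set (filter (\<lambda>z. z \<notin> C) zs) = X \<inter> S" using zs X disjoint by auto
    then show ?thesis using zs by (metis distinct_card distinct_filter)
  qed
  ultimately show ?thesis by simp
qed

text \<open>A trivial cycle meeting \<open>C\<close> would be linkable, so \<open>X\<close> has at
  least three vertices, and by \<open>card_clique_le\<close> at least half of them lie in
  \<open>S\<close>.\<close>

lemma two_le_card_S:
  assumes X: "cyc X" "\<not> linkable X" "X \<subseteq> S \<union> C" "X \<inter> C \<noteq> {}"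
  shows "2 \<le> card (X \<inter> S)"
proof -
  have "card X \<noteq> 1"
  proof
    assume "card X = 1"
    then obtain v where "X = {v}" by (auto simp: card_1_singleton_iff)
    then show False using X linkable_singleton by auto
  qed
  then have "3 \<le> card X" using cyc_card X by blast
  moreover have "card X = card (X \<inter> S) + card (X \<inter> C)"
  proof -
    have "X = (X \<inter> S) \<union> (X \<inter> C)" using X by auto
    then show ?thesis
      using card_Un_disjoint[of "X \<inter> S" "X \<inter> C"] disjoint cyc_finite[OF X(1)] by auto
  qed
  ultimately show ?thesis using card_clique_le[OF X(1-3)] by linarith
qed

text \<open>As \<open>X\<close> has at most two vertices in \<open>S\<close>, one of the two
  neighbours of \<open>s\<close> on the cycle lies in \<open>C\<close>. Cutting between
  \<open>s\<close> and that neighbour and putting \<open>c\<close> before \<open>s\<close> yields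
  the path. It rescues a leftover pair of clique vertices when \<open>card S = 2\<close>.\<close>

lemma linkable_insert:
  assumes X: "cyc X" "3 \<le> card X" "X \<subseteq> S \<union> C" "card (X \<inter> S) \<le> 2"
    and s: "s \<in> X" "s \<in> S" and c: "c \<in> C" "c \<notin> X" "E c s"
  shows "linkable (insert c X)"
proof -
  obtain ys where ys: "set (s # ys) = X" "distinct (s # ys)" "successively E (s # ys @ [s])"
    using cyc_rotate[OF X(1,2) s(1)] .
  have len: "2 \<le> length ys"
    using distinct_card[OF ys(2)] ys(1) X(2) by simp
  obtain a as b where eq: "ys = a # as @ [b]"
    using len by (cases ys; cases "tl ys" rule: rev_cases) auto
  have "a \<in> C \<or> b \<in> C"
  proof (rule ccontr)
    assume "\<not> ?thesis"
    then have "{s, a, b} \<subseteq> X \<inter> S" using X ys s by (auto simp: eq)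
    then have "card {s, a, b} \<le> card (X \<inter> S)"
      using card_mono finite_S by (metis finite_Int)
    then show False using X(4) ys(2) by (auto simp: eq)
  qed
  moreover have path: "successively E (s # ys)" "E (last ys) s"
    using ys(3) len successively_append_iff[of E "s # ys" "[s]"] by (auto split: if_splits)
  moreover have "successively E (s # rev ys)"
  proof -
    have "successively E ys" "ys \<noteq> []" using path(1) len by (auto simp: successively_Cons)
    then have "successively (\<lambda>u v. E v u) ys"
      by (elim successively_mono) (use E_sym in blast)
    then show ?thesis
      using E_sym[OF path(2)] \<open>ys \<noteq> []\<close> by (simp add: successively_Cons hd_rev)
  qed
  ultimately show ?thesis
  proof (elim disjE)
    assume "b \<in> C" "successively E (s # ys)"
    then show ?thesis using ys(1,2) c unfolding linkable_def
      by (intro disjI2 exI[of _ "c # s # ys"]) (auto simp: eq)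
  next
    assume "a \<in> C" "successively E (s # rev ys)"
    then show ?thesis using ys(1,2) c unfolding linkable_def
      by (intro disjI2 exI[of _ "c # s # rev ys"]) (auto simp: eq)
  qed
qed

section \<open>Partitions into cycles, and the insertion of clique vertices\<close>

definition cycle_partition :: "'a set \<Rightarrow> 'a set set \<Rightarrow> bool" where
  "cycle_partition V P \<longleftrightarrow> partition_on V P \<and> (\<forall>X\<in>P. cyc X)"

lemma cycle_partitionD:
  assumes "cycle_partition V P"
  shows "\<Union>P = V" "X \<in> P \<Longrightarrow> cyc X" "X \<in> P \<Longrightarrow> X \<subseteq> V"
    "X \<in> P \<Longrightarrow> Y \<in> P \<Longrightarrow> X \<noteq> Y \<Longrightarrow> X \<inter> Y = {}"
proof -
  have P: "partition_on V P" "\<forall>X\<in>P. cyc X" using assms by (simp_all add: cycle_partition_def)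
  show "\<Union>P = V" using partition_onD1[OF P(1)] by simp
  then show "X \<in> P \<Longrightarrow> X \<subseteq> V" by auto
  show "X \<in> P \<Longrightarrow> cyc X" using P(2) by simp
  show "X \<in> P \<Longrightarrow> Y \<in> P \<Longrightarrow> X \<noteq> Y \<Longrightarrow> X \<inter> Y = {}"
    by (rule disjointD[OF partition_onD2[OF P(1)]])
qed

lemma cycle_partition_finite:
  assumes "cycle_partition V P" "V \<subseteq> S \<union> C"
  shows "finite P"
proof (rule finite_elements)
  show "finite V" using assms(2) finite_S finite_C by (rule finite_subset[OF _ finite_UnI])
  show "partition_on V P" using assms(1) by (simp add: cycle_partition_def)
qed

lemma cycle_partition_subset:
  assumes "cycle_partition V P" "Q \<subseteq> P"
  shows "cycle_partition (\<Union>Q) Q"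
proof -
  have "disjoint Q" "{} \<notin> Q" "\<forall>X\<in>Q. cyc X"
    using assms pairwise_subset[of disjnt P Q]
    by (auto simp: cycle_partition_def partition_on_def)
  then show ?thesis by (simp add: cycle_partition_def partition_on_def)
qed

lemma cycle_partition_insert:
  assumes Q: "cycle_partition D Q" and Y: "cyc Y" "Y \<inter> D = {}"
  shows "cycle_partition (Y \<union> D) (insert Y Q)"
proof -
  have D: "D = \<Union>Q" "disjoint Q" "{} \<notin> Q" "\<forall>X\<in>Q. cyc X"
    using Q by (auto simp: cycle_partition_def partition_on_def)
  have "disjnt Y X" if "X \<in> Q" for X
    using that Y(2) D(1) by (auto simp: disjnt_def)
  then have "disjoint (insert Y Q)"
    using D(2) by (simp add: pairwise_insert disjnt_sym)
  then show ?thesis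
    using D Y(1) cyc_nonempty[of Y] by (simp add: cycle_partition_def partition_on_def)
qed

text \<open>The bound of \<open>card_clique_le\<close> is summed over the disjoint blocks. If
  \<open>S\<close> is a single vertex, no block can contain the two vertices of \<open>S\<close>
  that \<open>two_le_card_S\<close> requires.\<close>

lemma card_clique_Union_le:
  assumes Q: "cycle_partition D Q" "D \<subseteq> S \<union> C" "\<And>X. X \<in> Q \<Longrightarrow> \<not> linkable X"
  shows "card (D \<inter> C) \<le> card S" and "card S = 1 \<Longrightarrow> D \<inter> C = {}"
proof -
  note D = cycle_partitionD(1)[OF Q(1), symmetric] and cyc = cycle_partitionD(2)[OF Q(1)]
    and disj = cycle_partitionD(4)[OF Q(1)]
  have sub: "X \<subseteq> S \<union> C" if "X \<in> Q" for X using that D Q(2) by blast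
  have fin: "finite Q" using cycle_partition_finite[OF Q(1,2)] .
  have "card (D \<inter> C) = card (\<Union>X\<in>Q. X \<inter> C)" by (simp only: D Int_Union2)
  also have "\<dots> = (\<Sum>X\<in>Q. card (X \<inter> C))"
    by (rule card_UN_disjoint) (use fin finite_C disj in blast)+
  also have "\<dots> \<le> (\<Sum>X\<in>Q. card (X \<inter> S))"
    by (intro sum_mono card_clique_le cyc sub Q(3))
  also have "\<dots> = card (\<Union>X\<in>Q. X \<inter> S)"
    by (rule card_UN_disjoint[symmetric]) (use fin finite_S disj in blast)+
  also have "\<dots> \<le> card S"
    using finite_S by (intro card_mono) auto
  finally show "card (D \<inter> C) \<le> card S" .
  show "D \<inter> C = {}" if "card S = 1"
  proof (rule ccontr)
    assume "D \<inter> C \<noteq> {}"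
    then obtain X where X: "X \<in> Q" "X \<inter> C \<noteq> {}" using D by auto
    then have "2 \<le> card (X \<inter> S)" using two_le_card_S cyc sub Q(3) by blast
    also have "\<dots> \<le> card S" using finite_S by (intro card_mono) auto
    finally show False using that by simp
  qed
qed

definition coverable :: "'a set \<Rightarrow> nat \<Rightarrow> bool" where
  "coverable V r \<longleftrightarrow> (\<exists>P. cycle_partition V P \<and> card P \<le> r)"

lemma linkable_coverable:
  assumes "linkable Y" "card Y = 1 \<or> 3 \<le> card Y" "1 \<le> r"
  shows "coverable Y r"
proof -
  have "cyc Y" using linkable_cyc assms by blast
  then have "cycle_partition Y {Y}"
    using cyc_nonempty by (auto simp: cycle_partition_def intro: partition_on_space)
  then show ?thesis using assms(3) unfolding coverable_def by (intro exI[of _ "{Y}"]) simp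
qed

text \<open>All linkable blocks of the small cover are merged with the new clique vertices.\<close>

lemma coverable_add_clique:
  assumes K: "K \<subseteq> C" "(if card S = 1 then 0 else card S) < card K"
    and card_C: "2 * card S < card C" "S \<noteq> {}"
    and cov: "coverable (S \<union> K) r"
  shows "coverable (S \<union> C) r"
proof -
  obtain P where P: "cycle_partition (S \<union> K) P" "card P \<le> r"
    using cov unfolding coverable_def by auto
  note P' = cycle_partitionD(1-3)[OF P(1)] and disj = cycle_partitionD(4)[OF P(1)]
  have fin: "finite P" using cycle_partition_finite P K by blast
  define Q where "Q = {X \<in> P. \<not> linkable X}"
  define Y where "Y = (S \<union> C) - \<Union>Q"
  have Q: "cycle_partition (\<Union>Q) Q"
    using cycle_partition_subset P by (simp add: Q_def)
  have DQ: "\<Union>Q \<subseteq> S \<union> C" using P' K by (auto simp: Q_def)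
  note small = card_clique_Union_le[OF Q DQ]
  have card_D: "card (\<Union>Q \<inter> C) \<le> (if card S = 1 then 0 else card S)"
    using small by (auto simp: Q_def)
  \<comment> \<open>Some block is linkable, since otherwise the non-linkable blocks would contain
    all of \<open>K\<close>, more than they can. So the single new block \<open>Y\<close> replaces
    at least one old block and the cover does not grow.\<close>
  have "P \<noteq> Q"
  proof
    assume "P = Q"
    then have "\<Union>Q \<inter> C = K" using P' K disjoint by auto
    then show False using card_D K by simp
  qed
  then have "card Q < card P"
    using fin by (intro psubset_card_mono) (auto simp: Q_def)
  have "linkable (\<Union>X\<in>P - Q. X)"
    by (rule linkable_UN) (use fin disj in \<open>auto simp: Q_def\<close>)
  moreover have "(\<Union>X\<in>P - Q. X) \<subseteq> Y"
  proof -
    have "X \<inter> \<Union>Q = {}" "X \<subseteq> S \<union> C" if "X \<in> P - Q" for X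
      using that disj[of X] P'(1) K unfolding Q_def by blast+
    then show ?thesis unfolding Y_def by blast
  qed
  moreover have "Y - (\<Union>X\<in>P - Q. X) \<subseteq> C" using P'(1) unfolding Y_def by blast
  ultimately have "linkable Y" using linkable_superset by auto
  \<comment> \<open>If \<open>card S >= 2\<close>, at least \<open>card S + 1\<close> clique
    vertices remain for \<open>Y\<close>. If \<open>card S = 1\<close>, the kept blocks use none,
    and \<open>C\<close> has at least three.\<close>
  moreover have "3 \<le> card Y"
  proof -
    have "card C - card (\<Union>Q \<inter> C) = card (C - \<Union>Q)"
      using finite_C by (simp add: card_Diff_subset_Int Int_commute)
    also have "\<dots> \<le> card Y"
      using finite_C finite_S by (intro card_mono) (auto simp: Y_def)
    moreover have "card S > 0" using card_C finite_S by (simp add: card_gt_0_iff)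
    ultimately show ?thesis using card_D card_C by (auto split: if_splits)
  qed
  ultimately have "cyc Y" using linkable_cyc by blast
  then have "cycle_partition (Y \<union> \<Union>Q) (insert Y Q)"
    using Q by (intro cycle_partition_insert) (auto simp: Y_def)
  moreover have "Y \<union> \<Union>Q = S \<union> C" using DQ by (auto simp: Y_def)
  moreover have "card (insert Y Q) \<le> r"
    using \<open>card Q < card P\<close> P(2) fin by (auto simp: Q_def card_insert_if)
  ultimately show ?thesis unfolding coverable_def by metis
qed

end

section \<open>Removal of clique vertices by means of a crown\<close>

locale clique_reduction = clique_split +
  fixes A M :: "'a set" and own :: "'a \<Rightarrow> 'a"
  assumes M_sub: "M \<subseteq> C" and A_sub: "A \<subseteq> C" and not_A: "C - A \<subseteq> M"
    and own_S: "c \<in> M \<Longrightarrow> own c \<in> S" and own_E: "c \<in> M \<Longrightarrow> E (own c) c"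
    and two: "s \<in> S \<Longrightarrow> a \<in> A \<Longrightarrow> E s a \<Longrightarrow>
      \<exists>c1 c2. c1 \<in> A \<inter> M \<and> c2 \<in> A \<inter> M \<and> c1 \<noteq> c2 \<and> own c1 = s \<and> own c2 = s"
begin

text \<open>
  If a cycle is cut at its vertices in \<open>A\<close>, then the pieces become linkable once their end vertices
  in \<open>S\<close> are prolonged by vertices of \<open>A\<close> which they own.
\<close>

lemma linkable_piece:
  assumes w: "distinct w" "successively E w" "w \<noteq> []" "set w \<subseteq> S \<union> C" "set w \<inter> A = {}"
    and a: "a \<in> A" "E a (hd w)" and b: "b \<in> A" "E (last w) b"
  shows "\<exists>R \<subseteq> {c \<in> A \<inter> M. own c \<in> set w}. linkable (set w \<union> R)"
proof -
  obtain us where us: "set us \<subseteq> {c \<in> A \<inter> M. own c \<in> set w}" "distinct us" "successively E (us @ w)"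
      "hd (us @ w) \<in> C" "length us \<le> 1"
  proof (cases "hd w \<in> C")
    case True
    then show ?thesis using w by (intro that[of "[]"]) auto
  next
    case False
    then have "hd w \<in> S" using w hd_in_set by blast
    then obtain c where "c \<in> A \<inter> M" "own c = hd w" using two a E_sym by blast
    then show ?thesis using w own_E A_sub E_sym
      by (intro that[of "[c]"]) (fastforce simp: successively_Cons)+
  qed
  obtain vs where vs: "set vs \<subseteq> {c \<in> A \<inter> M. own c \<in> set w} - set us" "distinct vs"
      "successively E (w @ vs)" "last (w @ vs) \<in> C"
  proof (cases "last w \<in> C")
    case True
    then show ?thesis using w by (intro that[of "[]"]) auto
  next
    case False
    then have "last w \<in> S" using w last_in_set by blast
    then obtain c1 c2 where "c1 \<in> A \<inter> M" "c2 \<in> A \<inter> M" "c1 \<noteq> c2" "own c1 = last w" "own c2 = last w"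
      using two b by blast
    \<comment> \<open>\<open>us\<close> may already use one of the two vertices when
      \<open>w\<close> has only one vertex, so that both of its ends have the same owner. This is
      why each vertex of \<open>S\<close> needs to own two.\<close>
    moreover have "c1 \<notin> set us \<or> c2 \<notin> set us"
      using us(5) \<open>c1 \<noteq> c2\<close> by (cases us) auto
    ultimately obtain c where "c \<in> A \<inter> M" "own c = last w" "c \<notin> set us" by blast
    then show ?thesis using w own_E A_sub
      by (intro that[of "[c]"]) (fastforce simp: successively_append_iff)+
  qed
  have "linkable (set (us @ w @ vs))"
    unfolding linkable_def using us vs w
    by (intro disjI2 exI[of _ "us @ w @ vs"])
      (auto simp: successively_append_iff hd_append split: if_splits)
  then have "linkable (set w \<union> (set us \<union> set vs))" by (simp add: Un_ac)
  then show ?thesis using us vs by (intro exI[of _ "set us \<union> set vs"]) auto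
qed

text \<open>Induction cutting at the first vertex of \<open>A\<close>, which becomes the left
  neighbour of the remaining list. The prolongations of different pieces are disjoint because each
  added vertex has its owner inside its piece.\<close>

lemma linkable_pieces:
  assumes "distinct xs" "set xs \<subseteq> S \<union> C" "a \<in> A" "b \<in> A" "successively E (a # xs @ [b])"
  shows "\<exists>R \<subseteq> {c \<in> A \<inter> M. own c \<in> set xs}. linkable ((set xs - A) \<union> R)"
  using assms
proof (induction "length xs" arbitrary: xs a rule: less_induct)
  case less
  show ?case
  proof (cases "set xs \<inter> A = {}")
    case True
    show ?thesis
    proof (cases "xs = []")
      case False
      then show ?thesis
        using linkable_piece[of xs a b] less.prems True
        by (auto simp: successively_append_iff successively_Cons hd_append Diff_triv)
    qed auto
  next
    case False
    then have "\<exists>x\<in>set xs. x \<in> A" by auto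
    from split_list_first_prop[OF this]
    obtain w x ys where eq: "xs = w @ x # ys" and x: "x \<in> A" and w: "set w \<inter> A = {}"
      by auto
    obtain R where R: "R \<subseteq> {c \<in> A \<inter> M. own c \<in> set ys}" "linkable ((set ys - A) \<union> R)"
      using less.hyps[of ys x] less.prems x
      by (auto simp: eq successively_append_iff successively_Cons)
    obtain R' where R': "R' \<subseteq> {c \<in> A \<inter> M. own c \<in> set w}" "linkable (set w \<union> R')"
    proof (cases "w = []")
      case True
      then show ?thesis using that[of "{}"] by auto
    next
      case False
      have "\<exists>R \<subseteq> {c \<in> A \<inter> M. own c \<in> set w}. linkable (set w \<union> R)"
        using False less.prems x w
        by (intro linkable_piece[of w a x])
          (auto simp: eq successively_append_iff successively_Cons hd_append)
      then show ?thesis using that by auto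
    qed
    have "linkable ((set w \<union> R') \<union> ((set ys - A) \<union> R))"
      using R R' less.prems(1) w by (intro linkable_Un[OF R'(2) R(2)]) (auto simp: eq)
    moreover have "(set w \<union> R') \<union> ((set ys - A) \<union> R) = (set xs - A) \<union> (R' \<union> R)"
      using w x by (auto simp: eq)
    ultimately have "linkable ((set xs - A) \<union> (R' \<union> R))" by metis
    then show ?thesis using R R' by (intro exI[of _ "R' \<union> R"]) (auto simp: eq)
  qed
qed

text \<open>The cycle is opened at a vertex of \<open>A\<close>, which then bounds the list on both
  sides. A trivial cycle in \<open>A\<close> disappears and leaves the empty linkable set.\<close>

lemma cyc_meets_A:
  assumes X: "cyc X" "X \<subseteq> S \<union> C" "X \<inter> A \<noteq> {}"
  shows "\<exists>R \<subseteq> {c \<in> A \<inter> M. own c \<in> X}. linkable ((X - A) \<union> R)"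
proof (cases "card X = 1")
  case True
  then have "X - A = {}" using X by (auto simp: card_1_singleton_iff)
  then show ?thesis by (metis Un_empty_right empty_subsetI linkable_empty)
next
  case False
  then have "3 \<le> card X" using X cyc_card by blast
  moreover obtain a where a: "a \<in> X" "a \<in> A" using X by auto
  ultimately obtain ys where ys: "set (a # ys) = X" "distinct (a # ys)"
      "successively E (a # ys @ [a])"
    using cyc_rotate X(1) by blast
  then obtain R where "R \<subseteq> {c \<in> A \<inter> M. own c \<in> set ys}" "linkable ((set ys - A) \<union> R)"
    using linkable_pieces[of ys a a] X(2) a by auto
  moreover have "X - A = set ys - A" using ys a by auto
  ultimately show ?thesis using ys by (intro exI[of _ R]) auto
qed

text \<open>The blocks in \<open>Q\<close> are kept: they avoid \<open>A\<close>, and clique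
  vertices outside \<open>A\<close> belong to \<open>M\<close>. The other blocks lose their vertices
  in \<open>A\<close>, gain owned ones, and merge into the linkable set \<open>Z\<close>, which the
  rest of \<open>K\<close> extends to \<open>Y\<close>. If \<open>Y\<close> is a pair, the numerical
  hypotheses allow covering all of \<open>S \<union> K\<close> by one cycle instead.\<close>

lemma coverable_remove_clique:
  assumes K: "M \<subseteq> K" "K \<subseteq> C" and S: "S \<noteq> {}" "card S < card C"
    and card1: "card S = 1 \<Longrightarrow> card K = 2 \<Longrightarrow> card M = 2"
    and card2: "card S = 2 \<Longrightarrow> 3 \<le> card K \<and> card M + 2 \<noteq> card K"
    and card3: "3 \<le> card S \<Longrightarrow> card K = 2 * card S"
    and r: "1 \<le> r" and cov: "coverable (S \<union> C) r"
  shows "coverable (S \<union> K) r"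
proof -
  obtain P where P: "cycle_partition (S \<union> C) P" "card P \<le> r"
    using cov unfolding coverable_def by auto
  note P' = cycle_partitionD(1-3)[OF P(1)] and disj = cycle_partitionD(4)[OF P(1)]
  have fin: "finite P" using cycle_partition_finite P by blast
  define Q where "Q = {X \<in> P. \<not> linkable X \<and> X \<inter> A = {}}"
  define D where "D = \<Union>Q"
  define Y where "Y = (S \<union> K) - D"
  have Q: "cycle_partition D Q"
    using cycle_partition_subset P by (simp add: Q_def D_def)
  have DM: "D \<subseteq> S \<union> M"
  proof -
    have "X \<subseteq> S \<union> M" if "X \<in> Q" for X
      using that P'(3)[of X] not_A by (auto simp: Q_def)
    then show ?thesis by (auto simp: D_def)
  qed
  have DC: "D \<subseteq> S \<union> C" using DM M_sub by auto
  note small = card_clique_Union_le[OF Q DC]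
  have card_D: "card (D \<inter> C) \<le> card S" using small(1) by (auto simp: Q_def)
  \<comment> \<open>If all blocks were kept, these non-linkable cycles would contain all of
    \<open>C\<close>, although they contain at most \<open>card S\<close> clique vertices.\<close>
  have "P \<noteq> Q"
  proof
    assume "P = Q"
    then have "D \<inter> C = C" using P' by (auto simp: D_def)
    then show False using card_D S by simp
  qed
  then have "card Q < card P"
    using fin by (intro psubset_card_mono) (auto simp: Q_def)
  have "\<forall>X\<in>P - Q. \<exists>R \<subseteq> {c \<in> A \<inter> M. own c \<in> X}. linkable ((X - A) \<union> R)"
  proof
    fix X assume X: "X \<in> P - Q"
    show "\<exists>R \<subseteq> {c \<in> A \<inter> M. own c \<in> X}. linkable ((X - A) \<union> R)"
    proof (cases "X \<inter> A = {}")
      case True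
      then have "linkable X" using X by (auto simp: Q_def)
      then show ?thesis using True by (intro exI[of _ "{}"]) (auto simp: Diff_triv)
    next
      case False
      then show ?thesis using cyc_meets_A[of X] P'(2,3)[of X] X by simp
    qed
  qed
  from bchoice[OF this] obtain R
    where R: "\<And>X. X \<in> P - Q \<Longrightarrow> R X \<subseteq> {c \<in> A \<inter> M. own c \<in> X}"
      "\<And>X. X \<in> P - Q \<Longrightarrow> linkable ((X - A) \<union> R X)"
    by blast
  define Z where "Z = (\<Union>X\<in>P - Q. (X - A) \<union> R X)"
  have "linkable Z"
    unfolding Z_def
  proof (intro linkable_UN)
    \<comment> \<open>The added vertices lie in \<open>A\<close> and determine their block through
      their owner, so the parts are disjoint.\<close>
    fix X X' assume X: "X \<in> P - Q" "X' \<in> P - Q" "X \<noteq> X'"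
    then show "(X - A \<union> R X) \<inter> (X' - A \<union> R X') = {}"
      using disj[of X X'] R(1)[of X] R(1)[of X'] by blast
  qed (use fin R in auto)
  moreover have "Z \<subseteq> Y"
  proof
    fix x assume "x \<in> Z"
    then obtain X where X: "X \<in> P" "X \<notin> Q" "x \<in> X - A \<or> x \<in> R X"
      unfolding Z_def by blast
    from X(3) show "x \<in> Y"
    proof
      assume x: "x \<in> X - A"
      have "x \<notin> D"
      proof
        assume "x \<in> D"
        then obtain X' where "X' \<in> Q" "x \<in> X'" unfolding D_def by blast
        then show False using disj[of X X'] X x unfolding Q_def by blast
      qed
      moreover have "x \<in> S \<union> K" using P'(3)[OF X(1)] x not_A K(1) by blast
      ultimately show ?thesis by (simp add: Y_def)
    next
      assume "x \<in> R X"
      then have "x \<in> A" "x \<in> K" using R(1)[of X] X K(1) by auto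
      moreover have "x \<notin> D" using \<open>x \<in> A\<close> by (auto simp: D_def Q_def disjoint_iff)
      ultimately show ?thesis by (simp add: Y_def)
    qed
  qed
  moreover have "Y - Z \<subseteq> C"
  proof -
    have "x \<in> Z" if "x \<in> S" "x \<notin> D" for x
    proof -
      have "x \<in> \<Union>P" using that by (simp add: P'(1))
      then obtain X where "X \<in> P" "x \<in> X" by (rule UnionE)
      then have "X \<in> P - Q" "x \<in> X - A" using that A_sub disjoint by (auto simp: D_def)
      then show ?thesis by (auto simp: Z_def)
    qed
    then show ?thesis using K by (auto simp: Y_def)
  qed
  ultimately have link_Y: "linkable Y" using linkable_superset by auto
  have fin_K: "finite K" using K finite_C finite_subset by auto
  have fin_M: "finite M" using K fin_K finite_subset by auto
  have card_SK: "card (S \<union> K) = card S + card K"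
    using fin_K finite_S K disjoint by (intro card_Un_disjoint) auto
  have S0: "card S > 0" using S finite_S by (simp add: card_gt_0_iff)
  show ?thesis
  proof (cases "card Y = 2")
    case False
    have YD: "Y \<union> D = S \<union> K" "Y \<inter> D = {}" using DM K by (auto simp: Y_def)
    show ?thesis
    proof (cases "Y = {}")
      case True
      then have "cycle_partition (S \<union> K) Q" using Q YD by simp
      then show ?thesis
        using \<open>card Q < card P\<close> P(2) unfolding coverable_def by (meson le_trans less_imp_le)
    next
      case nonempty: False
      then have "card Y \<noteq> 0" using linkable_finite[OF link_Y] by simp
      then have "cyc Y" using False link_Y linkable_cyc[of Y] by linarith
      then have "cycle_partition (S \<union> K) (insert Y Q)"
        using Q YD cycle_partition_insert by metis
      moreover have "card (insert Y Q) \<le> r"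
        using \<open>card Q < card P\<close> P(2) fin by (auto simp: Q_def card_insert_if)
      ultimately show ?thesis unfolding coverable_def by metis
    qed
  next
    case True
    \<comment> \<open>A path on two vertices consists of its ends. Thus \<open>Y\<close> lies in
      \<open>C\<close>, and \<open>K\<close> is \<open>Y\<close> together with the clique vertices
      of the kept blocks.\<close>
    obtain p where p: "p \<noteq> []" "set p = Y" "distinct p" "hd p \<in> C" "last p \<in> C"
      using link_Y True unfolding linkable_def by auto
    moreover from this True have "length p = 2" using distinct_card by metis
    then have "set p = {hd p, last p}" using p(1) by (cases p; cases "tl p") auto
    ultimately have "Y \<subseteq> C" by auto
    then have KD: "K = Y \<union> (D \<inter> C)"
      using disjoint K DM unfolding Y_def by auto
    have "Y \<inter> (D \<inter> C) = {}" by (auto simp: Y_def)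
    then have card_K: "card K = 2 + card (D \<inter> C)"
      using KD True fin_K by (metis card_Un_disjoint finite_Un)
    have link_SK: "linkable (S \<union> K)"
    proof -
      \<comment> \<open>If \<open>card S >= 3\<close>, then \<open>card K = 2 * card S\<close>
        exceeds \<open>2 + card S\<close>, the largest value possible here.\<close>
      have "card S \<le> 2" using card_K card_D card3 by linarith
      then consider "card S = 1" | "card S = 2" using S0 by linarith
      then show ?thesis
      proof cases
        \<comment> \<open>Both vertices of \<open>K\<close> turn out to be owned by the only vertex
          \<open>s\<close> of \<open>S\<close>, which therefore links them.\<close>
        case 1
        then have "D \<inter> C = {}" using small(2) by (auto simp: Q_def)
        then have "card K = 2" using card_K by simp
        then have "card M = 2" using card1 1 by simp
        then have "M = K" using card_subset_eq[of K M] K fin_K \<open>card K = 2\<close> by simp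
        obtain c1 c2 where c: "K = {c1, c2}" "c1 \<noteq> c2"
          using \<open>card K = 2\<close> by (auto simp: card_2_iff)
        obtain s where s: "S = {s}" using 1 card_1_singletonE by blast
        have "own c1 = s" "own c2 = s" using own_S \<open>M = K\<close> c s by auto
        then have "E c1 s" "E s c2" using own_E[of c1] own_E[of c2] E_sym \<open>M = K\<close> c by auto
        then show ?thesis
          using c s K disjoint unfolding linkable_def
          by (intro disjI2 exI[of _ "[c1, s, c2]"]) auto
      next
        \<comment> \<open>As \<open>card K >= 3\<close>, some kept block meets \<open>C\<close>, so
          it contains both vertices of \<open>S\<close>. As \<open>card M + 2\<close> differs from
          \<open>card K\<close>, some owned vertex is outside \<open>D\<close>; it is adjacent to
          its owner in that block and opens the block to a path.\<close>
        case 2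
        have "D \<inter> C \<subseteq> M" using DM disjoint by auto
        moreover have "D \<inter> C \<noteq> M" using card_K card2[OF 2] by auto
        ultimately obtain c where c: "c \<in> M" "c \<notin> D" using M_sub by auto
        have "D \<inter> C \<noteq> {}" using card_K card2[OF 2] by auto
        then obtain X where X: "X \<in> Q" "X \<inter> C \<noteq> {}" by (auto simp: D_def)
        have cycX: "cyc X" "X \<subseteq> S \<union> C" "\<not> linkable X" using X P' by (auto simp: Q_def)
        have "2 \<le> card (X \<inter> S)" using two_le_card_S cycX X by blast
        then have "X \<inter> S = S" using 2 finite_S card_seteq[of S "X \<inter> S"] by simp
        have "3 \<le> card X"
        proof -
          have "card S < card X"
            using X(2) \<open>X \<inter> S = S\<close> disjoint cyc_finite[OF cycX(1)]
            by (intro psubset_card_mono) auto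
          then show ?thesis using 2 by simp
        qed
        moreover have "c \<notin> X" using c X by (auto simp: D_def)
        moreover have "E c (own c)" "own c \<in> S" using c own_E own_S E_sym by auto
        ultimately have "linkable (insert c X)"
          using cycX 2 c M_sub \<open>X \<inter> S = S\<close> by (intro linkable_insert[of X "own c"]) auto
        moreover have "insert c X \<subseteq> S \<union> K"
          using c K DM X by (auto simp: D_def)
        moreover have "(S \<union> K) - insert c X \<subseteq> C" using \<open>X \<inter> S = S\<close> K by auto
        ultimately show ?thesis using linkable_superset by blast
      qed
    qed
    moreover have "3 \<le> card (S \<union> K)" using card_SK card_K S0 by linarith
    ultimately show ?thesis using linkable_coverable r by blast
  qed
qed

end

section \<open>From lists of vertices in a digraph to partitions\<close>

lemma vwalk_with_proj:
  "vwalk p (with_proj H) \<longleftrightarrow> set p \<subseteq> pverts H \<and> p \<noteq> [] \<and> successively (\<lambda>u v. (u, v) \<in> parcs H) p"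
proof -
  have "set (vwalk_arcs p) \<subseteq> parcs H \<longleftrightarrow> successively (\<lambda>u v. (u, v) \<in> parcs H) p"
    by (induction p rule: vwalk_arcs.induct) auto
  then show ?thesis by (auto simp: vwalk_def)
qed

text \<open>Adjacency inside an induced subgraph is that of \<open>E\<close>, so a single relation
  serves for the graph and for its kernel.\<close>

lemma cycle_verts_induced:
  assumes H: "parcs H = {(u, v). u \<in> pverts H \<and> v \<in> pverts H \<and> E u v}"
  shows "cycle_verts (with_proj H) c \<longleftrightarrow> set c \<subseteq> pverts H \<and> distinct c \<and> successively E c \<and>
    (length c = 1 \<or> 3 \<le> length c \<and> E (last c) (hd c))"
proof (cases "c \<noteq> [] \<and> set c \<subseteq> pverts H")
  case True
  then have "successively (\<lambda>u v. (u, v) \<in> parcs H) c \<longleftrightarrow> successively E c"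
    by (intro successively_cong) (auto simp: H)
  moreover have "(last c, hd c) \<in> parcs H \<longleftrightarrow> E (last c) (hd c)"
    using True by (auto simp: H)
  ultimately show ?thesis
    using True by (auto simp: cycle_verts_def vpath_def vwalk_with_proj)
next
  case False
  then show ?thesis by (auto simp: cycle_verts_def vpath_def vwalk_with_proj)
qed

context clique_split
begin

text \<open>Cycles are sent to their vertex sets, and conversely a list is chosen for every block.
  Neither direction can increase the number.\<close>

lemma has_cycle_cover_iff_coverable:
  assumes H: "parcs H = {(u, v). u \<in> pverts H \<and> v \<in> pverts H \<and> E u v}"
    and sub: "pverts H \<subseteq> S \<union> C"
  shows "has_cycle_cover_of_size_le (with_proj H) r \<longleftrightarrow> coverable (pverts H) r"
proof
  assume "has_cycle_cover_of_size_le (with_proj H) r"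
  then obtain D where D: "cycle_cover (with_proj H) D" "finite D" "card D \<le> r"
    by (auto simp: has_cycle_cover_of_size_le_def)
  then have cyc: "set c \<subseteq> pverts H \<and> cyc (set c)" if "c \<in> D" for c
    using that unfolding cycle_cover_def cycle_verts_induced[OF H] cyc_def by blast
  have "partition_on (pverts H) (set ` D)"
  proof (rule partition_onI)
    show "\<Union> (set ` D) = pverts H"
    proof
      show "\<Union> (set ` D) \<subseteq> pverts H" using cyc by blast
      show "pverts H \<subseteq> \<Union> (set ` D)" using D(1) by (fastforce simp: cycle_cover_def)
    qed
    show "disjnt X Y" if XY: "X \<in> set ` D" "Y \<in> set ` D" "X \<noteq> Y" for X Y
    proof -
      obtain c d where cd: "c \<in> D" "X = set c" "d \<in> D" "Y = set d" using XY by blast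
      have "pairwise (\<lambda>c d. set c \<inter> set d = {}) D" using D(1) by (simp add: cycle_cover_def)
      from pairwiseD[OF this cd(1,3)] show ?thesis using XY(3) cd(2,4) by (auto simp: disjnt_def)
    qed
    show "{} \<notin> set ` D" using cyc cyc_nonempty by (metis image_iff)
  qed
  moreover have "card (set ` D) \<le> r" using card_image_le[OF D(2), of set] D(3) by simp
  ultimately show "coverable (pverts H) r"
    using cyc unfolding coverable_def cycle_partition_def by blast
next
  assume "coverable (pverts H) r"
  then obtain P where P: "cycle_partition (pverts H) P" "card P \<le> r" by (auto simp: coverable_def)
  note P' = cycle_partitionD[OF P(1)]
  have fin: "finite P" using cycle_partition_finite P(1) sub by blast
  have "\<forall>X\<in>P. \<exists>c. set c = X \<and> cycle_verts (with_proj H) c"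
  proof
    fix X assume "X \<in> P"
    then show "\<exists>c. set c = X \<and> cycle_verts (with_proj H) c"
      using P'(2,3)[of X] unfolding cyc_def cycle_verts_induced[OF H] by metis
  qed
  from bchoice[OF this] obtain f where f: "\<And>X. X \<in> P \<Longrightarrow> set (f X) = X"
      "\<And>X. X \<in> P \<Longrightarrow> cycle_verts (with_proj H) (f X)"
    by blast
  have "cycle_cover (with_proj H) (f ` P)"
    unfolding cycle_cover_def
  proof (intro conjI ballI)
    show "pairwise (\<lambda>c d. set c \<inter> set d = {}) (f ` P)"
      unfolding pairwise_image by (intro pairwiseI) (metis P'(4) f(1))
    fix v assume "v \<in> verts (with_proj H)"
    then have "v \<in> \<Union>P" using P'(1) by simp
    then obtain X where X: "X \<in> P" "v \<in> X" by (rule UnionE)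
    show "\<exists>!c. c \<in> f ` P \<and> v \<in> set c"
    proof (rule ex1I[of _ "f X"])
      show "f X \<in> f ` P \<and> v \<in> set (f X)" using X f(1) by simp
      fix c assume "c \<in> f ` P \<and> v \<in> set c"
      then obtain Y where Y: "Y \<in> P" "c = f Y" "v \<in> Y" using f(1) by auto
      then have "Y = X" using P'(4)[of X Y] X by blast
      then show "c = f X" using Y by simp
    qed
  qed (use f(2) in auto)
  moreover have "card (f ` P) \<le> r" using card_image_le[OF fin, of f] P(2) by simp
  ultimately show "has_cycle_cover_of_size_le (with_proj H) r"
    using fin unfolding has_cycle_cover_of_size_le_def by blast
qed

end

section \<open>Total correctness with time bounds\<close>

text \<open>Some execution suffices because \<open>exec\<close> is deterministic. The bound
  \<open>t\<close> is the same for all initial stores, so bounds can be composed without inspecting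
  the store.\<close>

definition total :: "(store \<Rightarrow> bool) \<Rightarrow> com \<Rightarrow> nat \<Rightarrow> (store \<Rightarrow> bool) \<Rightarrow> bool" where
  "total P c t Q \<longleftrightarrow> (\<forall>s. P s \<longrightarrow> (\<exists>u s'. exec c s u s' \<and> u \<le> t \<and> Q s'))"

lemma totalE:
  assumes "total P c t Q" "P s"
  obtains u s' where "exec c s u s'" "u \<le> t" "Q s'"
  using assms unfolding total_def by blast

lemma total_conseq:
  "total P c t Q \<Longrightarrow> (\<And>s. P' s \<Longrightarrow> P s) \<Longrightarrow> (\<And>s. Q s \<Longrightarrow> Q' s) \<Longrightarrow> total P' c t Q'"
  unfolding total_def by blast

lemma total_Ex: "(\<And>x. total (P x) c t Q) \<Longrightarrow> total (\<lambda>s. \<exists>x. P x s) c t Q"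
  unfolding total_def by blast

lemma total_conj: "total P c t Q \<Longrightarrow> total (\<lambda>s. P s \<and> R) c t (\<lambda>s. Q s \<and> R)"
  unfolding total_def by blast

lemma total_Seq: "total P c1 t1 R \<Longrightarrow> total R c2 t2 Q \<Longrightarrow> total P (Seq c1 c2) (t1 + t2) Q"
  unfolding total_def by (meson Seq add_mono)

lemma total_If:
  assumes "total (\<lambda>s. P s \<and> bval b s) c1 t Q" "total (\<lambda>s. P s \<and> \<not> bval b s) c2 t Q"
  shows "total P (If b c1 c2) (t + 1) Q"
  using assms unfolding total_def by (meson IfTrue IfFalse add_le_mono1)

text \<open>The variant \<open>m\<close> drops in each iteration and starts at most at
  \<open>B\<close>, so there are at most \<open>B\<close> iterations. Each costs its body and one
  test; the last summand is the failing test.\<close>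

lemma total_While:
  fixes m :: "store \<Rightarrow> nat"
  assumes body: "\<And>k. total (\<lambda>s. I s \<and> bval b s \<and> m s = k) c t (\<lambda>s. I s \<and> m s < k)"
    and bound: "\<And>s. I s \<Longrightarrow> m s \<le> B"
  shows "total I (While b c) (B * (t + 1) + 1) (\<lambda>s. I s \<and> \<not> bval b s)"
proof -
  have "\<exists>u s'. exec (While b c) s u s' \<and> u \<le> m s * (t + 1) + 1 \<and> I s' \<and> \<not> bval b s'"
    if "I s" for s
    using that
  proof (induction "m s" arbitrary: s rule: less_induct)
    case less
    show ?case
    proof (cases "bval b s")
      case True
      then obtain u s1 where 1: "exec c s u s1" "u \<le> t" "I s1" "m s1 < m s"
        using body[of "m s"] less.prems unfolding total_def by blast
      then obtain u' s' where 2: "exec (While b c) s1 u' s'" "u' \<le> m s1 * (t + 1) + 1"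
          "I s'" "\<not> bval b s'"
        using less.hyps by blast
      have "Suc (m s1) * (t + 1) \<le> m s * (t + 1)" using 1(4) by (intro mult_le_mono1) simp
      then have "u + u' + 1 \<le> m s * (t + 1) + 1" using 1(2) 2(2) by simp
      then show ?thesis using WhileTrue[OF True 1(1) 2(1)] 2 by blast
    next
      case False
      then have "exec (While b c) s 1 s" by (rule WhileFalse)
      then show ?thesis using less.prems False by (intro exI[of _ 1] exI[of _ s]) simp
    qed
  qed
  moreover have "m s * (t + 1) + 1 \<le> B * (t + 1) + 1" if "I s" for s
    by (intro add_le_mono1 mult_le_mono1 bound that)
  ultimately show ?thesis unfolding total_def by (meson le_trans)
qed

primrec loop_free :: "com \<Rightarrow> bool" where
  "loop_free Skip = True"
| "loop_free (Assign x a b) = True"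
| "loop_free (Seq c1 c2) = (loop_free c1 \<and> loop_free c2)"
| "loop_free (If b c1 c2) = (loop_free c1 \<and> loop_free c2)"
| "loop_free (While b c) = False"

text \<open>A functional semantics for loop-free programs, whose verification thereby becomes
  simplification.\<close>

primrec result :: "com \<Rightarrow> store \<Rightarrow> store" where
  "result Skip s = s"
| "result (Assign x a b) s = s(x := (s x)(aval a s := aval b s))"
| "result (Seq c1 c2) s = result c2 (result c1 s)"
| "result (If b c1 c2) s = (if bval b s then result c1 s else result c2 s)"
| "result (While b c) s = s"

text \<open>An upper bound that ignores the store; hence a conditional is charged for both
  branches.\<close>

primrec cost :: "com \<Rightarrow> nat" where
  "cost Skip = 1"
| "cost (Assign x a b) = 1"
| "cost (Seq c1 c2) = cost c1 + cost c2"
| "cost (If b c1 c2) = cost c1 + cost c2 + 1"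
| "cost (While b c) = 0"

lemma exec_result: "loop_free c \<Longrightarrow> \<exists>u. exec c s u (result c s) \<and> u \<le> cost c"
proof (induction c arbitrary: s)
  case Skip
  then show ?case by (auto intro!: exI[of _ 1] exec.Skip)
next
  case (Assign x a b)
  then show ?case using exec.Assign[of x a b s] by (intro exI[of _ 1]) (simp del: fun_upd_apply)
next
  case (Seq c1 c2)
  then show ?case by simp (meson exec.Seq add_mono)
next
  case (If b c1 c2)
  then obtain u1 u2 where u: "exec c1 s u1 (result c1 s)" "u1 \<le> cost c1"
      "exec c2 s u2 (result c2 s)" "u2 \<le> cost c2"
    by simp meson
  show ?case
  proof (cases "bval b s")
    case True
    then show ?thesis using u exec.IfTrue[OF True u(1), of c2]
      by (intro exI[of _ "u1 + 1"]) simp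
  next
    case False
    then show ?thesis using u exec.IfFalse[OF False u(3), of c1]
      by (intro exI[of _ "u2 + 1"]) simp
  qed
qed simp

lemma total_loop_free:
  assumes "loop_free c" "\<And>s. P s \<Longrightarrow> Q (result c s)" "cost c \<le> t"
  shows "total P c t Q"
  unfolding total_def using exec_result[OF assms(1)] assms(2,3) by (meson le_trans)

abbreviation var :: "vname \<Rightarrow> aexp" where
  "var x \<equiv> Get x (N 0)"

abbreviation set_var :: "vname \<Rightarrow> aexp \<Rightarrow> com" where
  "set_var x a \<equiv> Assign x (N 0) a"

abbreviation nonzero :: "aexp \<Rightarrow> bexp" where
  "nonzero a \<equiv> Less (N 0) a"

definition For :: "vname \<Rightarrow> com \<Rightarrow> com" where
  "For x c = Seq (set_var x (N 0)) (While (Less (var x) (var ''n''))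
     (Seq c (set_var x (Plus (var x) (N 1)))))"

text \<open>The invariant is indexed by the number of completed iterations and insensitive to the
  counter cell, so incrementing the counter preserves it. Test and increment cost two steps per
  iteration; initialization and final test cost two more.\<close>

lemma total_For:
  assumes body: "\<And>i. i < n \<Longrightarrow> total (\<lambda>s. I i s \<and> s x 0 = i) c t (\<lambda>s. I (Suc i) s \<and> s x 0 = i)"
    and indep: "\<And>i s v. I i s \<Longrightarrow> I i (s(x := (s x)(0 := v)))"
    and n: "\<And>i s. I i s \<Longrightarrow> s ''n'' 0 = n" and x: "x \<noteq> ''n''"
  shows "total (I 0) (For x c) (n * (t + 2) + 2) (I n)"
proof -
  define J where "J = (\<lambda>s. I (s x 0) s \<and> s x 0 \<le> n)"
  let ?inc = "set_var x (Plus (var x) (N 1))"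
  have "total (\<lambda>s. J s \<and> bval (Less (var x) (var ''n'')) s \<and> n - s x 0 = k)
      (Seq c ?inc) (t + 1) (\<lambda>s. J s \<and> n - s x 0 < k)" for k
  proof (rule total_Seq)
    show "total (\<lambda>s. J s \<and> bval (Less (var x) (var ''n'')) s \<and> n - s x 0 = k) c t
        (\<lambda>s. \<exists>i<n. I (Suc i) s \<and> s x 0 = i \<and> n - i = k)"
      unfolding total_def
    proof (intro allI impI)
      fix s assume s: "J s \<and> bval (Less (var x) (var ''n'')) s \<and> n - s x 0 = k"
      then have I: "I (s x 0) s" "s x 0 < n" using n by (auto simp: J_def)
      then obtain u s' where "exec c s u s'" "u \<le> t" "I (Suc (s x 0)) s'" "s' x 0 = s x 0"
        using body[of "s x 0"] unfolding total_def by blast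
      then show "\<exists>u s'. exec c s u s' \<and> u \<le> t \<and> (\<exists>i<n. I (Suc i) s' \<and> s' x 0 = i \<and> n - i = k)"
        using I s by blast
    qed
    show "total (\<lambda>s. \<exists>i<n. I (Suc i) s \<and> s x 0 = i \<and> n - i = k) ?inc 1
        (\<lambda>s. J s \<and> n - s x 0 < k)"
      by (rule total_loop_free) (auto simp: J_def indep)
  qed
  then have "total J (While (Less (var x) (var ''n'')) (Seq c ?inc)) (n * (t + 1 + 1) + 1)
      (\<lambda>s. J s \<and> \<not> bval (Less (var x) (var ''n'')) s)"
    by (rule total_While) simp
  then have loop: "total J (While (Less (var x) (var ''n'')) (Seq c ?inc)) (n * (t + 1 + 1) + 1) (I n)"
  proof (rule total_conseq)
    fix s assume "J s \<and> \<not> bval (Less (var x) (var ''n'')) s"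
    then have "I (s x 0) s" "s x 0 = n" using n by (auto simp: J_def)
    then show "I n s" by simp
  qed
  have "total (I 0) (set_var x (N 0)) 1 J"
    by (rule total_loop_free) (auto simp: J_def indep)
  from total_Seq[OF this loop] show ?thesis by (simp add: For_def)
qed

definition poly_time :: "(nat \<Rightarrow> nat) \<Rightarrow> bool" where
  "poly_time f \<longleftrightarrow> (\<exists>p :: nat poly. \<forall>n. f n = poly p n)"

lemma poly_time_const: "poly_time (\<lambda>_. k)"
  unfolding poly_time_def by (intro exI[of _ "[:k:]"]) simp

lemma poly_time_id: "poly_time (\<lambda>n. n)"
  unfolding poly_time_def by (intro exI[of _ "[:0, 1:]"]) simp

lemma poly_time_add: "poly_time f \<Longrightarrow> poly_time g \<Longrightarrow> poly_time (\<lambda>n. f n + g n)"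
  unfolding poly_time_def by (metis poly_add)

lemma poly_time_mult: "poly_time f \<Longrightarrow> poly_time g \<Longrightarrow> poly_time (\<lambda>n. f n * g n)"
  unfolding poly_time_def by (metis poly_mult)

section \<open>The auction\<close>

locale assignment =
  fixes n :: nat and S :: "nat set" and E :: "nat \<Rightarrow> nat \<Rightarrow> bool"
  assumes S_sub: "S \<subseteq> {..<n}" and S_nonempty: "S \<noteq> {}"
begin

definition nbr :: "nat \<Rightarrow> nat \<Rightarrow> bool" where
  "nbr s c \<longleftrightarrow> c < n \<and> c \<notin> S \<and> E s c"

text \<open>
  Each vertex of \<open>S\<close> bids for two clique vertices. It always takes a neighbour of minimum price
  \<open>lev\<close>, whose price then increases by one and whose previous owner bids again; it gives up when all
  its neighbours have price at least \<open>n\<close>. The value \<open>Suc s\<close> of \<open>own c\<close> stands for the owner \<open>s\<close>.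
\<close>

definition prices :: "(nat \<Rightarrow> nat) \<Rightarrow> (nat \<Rightarrow> nat) \<Rightarrow> bool" where
  "prices lev own \<longleftrightarrow>
     (\<forall>c<n. lev c \<le> n \<and> (own c = 0 \<longleftrightarrow> lev c = 0)) \<and>
     (\<forall>c<n. \<forall>s. own c = Suc s \<longrightarrow> s \<in> S \<and> nbr s c \<and> (\<forall>c'. nbr s c' \<longrightarrow> lev c \<le> Suc (lev c')))"

definition holds :: "(nat \<Rightarrow> nat) \<Rightarrow> nat \<Rightarrow> nat" where
  "holds own s = card {c. c < n \<and> own c = Suc s}"

text \<open>\<open>T s\<close> is the number of vertices \<open>s\<close> has asked for so far.
  \<open>pend\<close> uses the same shift by one as \<open>own\<close>, and 0 means that nobody
  bids. The pending bidder is credited with one vertex in advance, so that demand stays balanced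
  while ownership changes.\<close>

definition served :: "(nat \<Rightarrow> nat) \<Rightarrow> (nat \<Rightarrow> nat) \<Rightarrow> nat \<Rightarrow> (nat \<Rightarrow> nat) \<Rightarrow> bool" where
  "served lev own pend T \<longleftrightarrow> (pend = 0 \<or> pend - 1 \<in> S) \<and>
     (\<forall>s\<in>S. let h = holds own s + (if pend = Suc s then 1 else 0)
       in h \<le> T s \<and> (h = T s \<or> (\<forall>c. nbr s c \<longrightarrow> n \<le> lev c)))"

text \<open>Away from \<open>b\<close> the held vertices do not change. The identity says that
  swapping owner and pending bidder preserves holdings plus credit.\<close>

lemma holds_swap:
  assumes "b < n"
  shows "holds (own(b := p)) s + (if own b = Suc s then 1 else 0) =
    holds own s + (if p = Suc s then 1 else 0)"
proof -
  let ?R = "{c. c < n \<and> c \<noteq> b \<and> own c = Suc s}"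
  have fin: "finite ?R" "b \<notin> ?R" by auto
  have "{c. c < n \<and> (own(b := q)) c = Suc s} = (if q = Suc s then insert b ?R else ?R)" for q
    using assms by auto
  then have "holds (own(b := q)) s = card ?R + (if q = Suc s then 1 else 0)" for q
    using fin unfolding holds_def by (simp del: fun_upd_apply)
  from this[of p] this[of "own b"] show ?thesis by simp
qed

text \<open>For the new owner the price bound holds because \<open>b\<close> was a cheapest
  neighbour. For all others it is only relaxed, since no price falls.\<close>

lemma prices_step:
  assumes "prices lev own" "s \<in> S" "nbr s b" "lev b < n" "\<And>c. nbr s c \<Longrightarrow> lev b \<le> lev c"
  shows "prices (lev(b := Suc (lev b))) (own(b := Suc s))"
  unfolding prices_def
proof (intro conjI allI impI)
  fix c assume "c < n"
  then show "(lev(b := Suc (lev b))) c \<le> n"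
    and "((own(b := Suc s)) c = 0) = ((lev(b := Suc (lev b))) c = 0)"
    using assms by (auto simp: prices_def)
next
  fix c s' assume c: "c < n" "(own(b := Suc s)) c = Suc s'"
  show "s' \<in> S" "nbr s' c" using assms c by (auto simp: prices_def split: if_splits)
  fix c' assume c': "nbr s' c'"
  show "(lev(b := Suc (lev b))) c \<le> Suc ((lev(b := Suc (lev b))) c')"
  proof (cases "c = b")
    case True
    then show ?thesis using assms c c' by auto
  next
    case False
    then have "lev c \<le> Suc (lev c')" using assms(1) c c' by (auto simp: prices_def)
    then show ?thesis using False by auto
  qed
qed

text \<open>Holdings plus credit are preserved by \<open>holds_swap\<close>, and a price that has
  reached \<open>n\<close> stays at least \<open>n\<close>.\<close>

lemma served_step:
  assumes "prices lev own" "served lev own (Suc s) T" "b < n"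
  shows "served (lev(b := Suc (lev b))) (own(b := Suc s)) (own b) T"
proof -
  have "own b = 0 \<or> own b - 1 \<in> S" using assms(1,3) by (cases "own b") (auto simp: prices_def)
  moreover have "n \<le> (lev(b := Suc (lev b))) c" if "n \<le> lev c" for c using that by auto
  ultimately show ?thesis
    using assms(2) holds_swap[OF assms(3), of own "Suc s"]
    unfolding served_def Let_def by (metis (no_types, lifting))
qed

lemma served_start:
  assumes "served lev own 0 T" "s \<in> S"
  shows "served lev own (Suc s) (T(s := Suc (T s)))"
  using assms unfolding served_def Let_def by auto

text \<open>Dropping the credit leaves only \<open>s\<close> short of its demand, and
  \<open>s\<close> is excused as it has no neighbour cheaper than \<open>n\<close>.\<close>

lemma served_give_up:
  assumes "served lev own (Suc s) T" "\<And>c. nbr s c \<Longrightarrow> n \<le> lev c"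
  shows "served lev own 0 T"
  unfolding served_def Let_def
proof (intro conjI ballI)
  fix s' assume "s' \<in> S"
  then have "holds own s' + (if Suc s = Suc s' then 1 else 0) \<le> T s' \<and>
      (holds own s' + (if Suc s = Suc s' then 1 else 0) = T s' \<or> (\<forall>c. nbr s' c \<longrightarrow> n \<le> lev c))"
    using assms(1) unfolding served_def Let_def by blast
  then show "holds own s' + (if 0 = Suc s' then 1 else 0) \<le> T s'"
    and "holds own s' + (if 0 = Suc s' then 1 else 0) = T s' \<or> (\<forall>c. nbr s' c \<longrightarrow> n \<le> lev c)"
    using assms(2) by (auto split: if_splits)
qed simp

text \<open>Together with \<open>sum_prices_step\<close> this limits the number of successful
  bids.\<close>

lemma sum_prices_le: "prices lev own \<Longrightarrow> (\<Sum>c<n. lev c) \<le> n * n"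
  using sum_bounded_above[of "{..<n}" lev n] by (simp add: prices_def)

lemma sum_prices_step:
  assumes "b < n"
  shows "(\<Sum>c<n. (lev(b := Suc (lev b))) c) = Suc (\<Sum>c<n. lev c :: nat)"
proof -
  have "(\<Sum>c<n. (lev(b := v)) c) = v + (\<Sum>c\<in>{..<n} - {b}. lev c)" for v :: nat
    using assms by (subst sum.remove[of _ b]) (auto intro!: sum.cong)
  from this[of "Suc (lev b)"] this[of "lev b"] show ?thesis by simp
qed

text \<open>Every owned vertex has its owner in \<open>S\<close>, and nobody holds more than the two
  vertices asked for.\<close>

lemma card_owned_le:
  assumes "prices lev own" "served lev own 0 (\<lambda>_. 2)"
  shows "card {c. c < n \<and> own c \<noteq> 0} \<le> 2 * card S"
proof -
  have "{c. c < n \<and> own c \<noteq> 0} \<subseteq> (\<Union>s\<in>S. {c. c < n \<and> own c = Suc s})"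
    using assms(1) by (auto simp: prices_def gr0_conv_Suc)
  moreover have fin: "finite S" using S_sub finite_subset by blast
  ultimately have "card {c. c < n \<and> own c \<noteq> 0} \<le> card (\<Union>s\<in>S. {c. c < n \<and> own c = Suc s})"
    by (intro card_mono) auto
  also have "\<dots> \<le> (\<Sum>s\<in>S. holds own s)"
    unfolding holds_def by (rule card_UN_le[OF fin])
  also have "\<dots> \<le> (\<Sum>s\<in>S. 2)"
    using assms(2) by (intro sum_mono) (auto simp: served_def Let_def)
  finally show ?thesis by simp
qed

text \<open>Fewer than \<open>n\<close> clique vertices leave some price between 1 and \<open>n\<close> unused.\<close>

lemma price_gap:
  obtains j where "1 \<le> j" "j \<le> n" "\<And>c. c < n \<Longrightarrow> c \<notin> S \<Longrightarrow> lev c \<noteq> j"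
proof -
  have "card (lev ` ({..<n} - S)) \<le> card ({..<n} - S)" by (intro card_image_le) auto
  also have "\<dots> < card {..<n}" using S_sub S_nonempty by (intro psubset_card_mono) auto
  finally have "card (lev ` ({..<n} - S)) < card {1..n}" by simp
  then have "\<not> {1..n} \<subseteq> lev ` ({..<n} - S)"
    by (meson card_mono finite_Diff finite_imageI finite_lessThan not_le)
  then show ?thesis using that by fastforce
qed

lemma gap_structure:
  assumes "prices lev own" "served lev own 0 (\<lambda>_. 2)"
  obtains A where "A \<subseteq> {..<n} - S" "({..<n} - S) - A \<subseteq> {c. c < n \<and> own c \<noteq> 0}"
    "\<And>s a. s \<in> S \<Longrightarrow> a \<in> A \<Longrightarrow> E s a \<Longrightarrow> \<exists>c1 c2. c1 \<in> A \<and> c2 \<in> A \<and> c1 \<noteq> c2 \<and>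
       own c1 = Suc s \<and> own c2 = Suc s"
proof -
  obtain j where j: "1 \<le> j" "j \<le> n" "\<And>c. c < n \<Longrightarrow> c \<notin> S \<Longrightarrow> lev c \<noteq> j"
    using price_gap[of lev] by blast
  show ?thesis
  proof (rule that[of "{c. c < n \<and> c \<notin> S \<and> lev c < j}"])
    show "{..<n} - S - {c. c < n \<and> c \<notin> S \<and> lev c < j} \<subseteq> {c. c < n \<and> own c \<noteq> 0}"
      using assms(1) j by (auto simp: prices_def)
    fix s a assume s: "s \<in> S" and a: "a \<in> {c. c < n \<and> c \<notin> S \<and> lev c < j}" "E s a"
    then have nbr: "nbr s a" by (auto simp: nbr_def)
    have "holds own s = 2"
      using assms(2) s nbr a(1) j(2) unfolding served_def Let_def by fastforce
    then obtain c1 c2 where c: "{c. c < n \<and> own c = Suc s} = {c1, c2}" "c1 \<noteq> c2"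
      by (auto simp: holds_def card_2_iff)
    have "x < n \<and> x \<notin> S \<and> lev x < j \<and> own x = Suc s" if "x \<in> {c1, c2}" for x
    proof -
      have x: "x < n" "own x = Suc s" using that c(1) by blast+
      then have "nbr s x" "lev x \<le> Suc (lev a)" using assms(1) nbr by (auto simp: prices_def)
      then show ?thesis using x j(3)[of x] a(1) by (auto simp: nbr_def)
    qed
    then show "\<exists>c1 c2. c1 \<in> {c. c < n \<and> c \<notin> S \<and> lev c < j} \<and> c2 \<in> {c. c < n \<and> c \<notin> S \<and> lev c < j} \<and>
        c1 \<noteq> c2 \<and> own c1 = Suc s \<and> own c2 = Suc s"
      using c(2) by blast
  qed auto
qed

end

section \<open>The program\<close>

text \<open>The machine cannot multiply, so the row offsets of the adjacency matrix are tabulated by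
  repeated addition.\<close>

definition init_rows :: com where
  "init_rows = Seq (Assign ''row'' (N 0) (N 0))
     (For ''i'' (Assign ''row'' (Plus (var ''i'') (N 1)) (Plus (Get ''row'' (var ''i'')) (var ''n''))))"

text \<open>\<open>l\<close> starts at \<open>n\<close> and the comparison is strict, so
  \<open>l = n\<close> at the end signals that no neighbour of the bidder is cheaper than
  \<open>n\<close>; only otherwise is \<open>b\<close> meaningful.\<close>

definition find_best :: com where
  "find_best = Seq (set_var ''l'' (var ''n'')) (For ''j''
     (If (And (Eq (Get ''S'' (var ''j'')) (N 0))
           (And (nonzero (Get ''E'' (Plus (Get ''row'' (Minus (var ''pend'') (N 1))) (var ''j''))))
             (Less (Get ''lev'' (var ''j'')) (var ''l''))))
       (Seq (set_var ''b'' (var ''j'')) (set_var ''l'' (Get ''lev'' (var ''j''))))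
       Skip))"

text \<open>The entry of \<open>own\<close> and \<open>pend\<close> are swapped in encoded form. If
  the vertex had no owner, the 0 that arrives in \<open>pend\<close> ends the bidding, just as
  giving up does.\<close>

definition take_best :: com where
  "take_best = If (Less (var ''l'') (var ''n''))
     (Seq (set_var ''tmp'' (Get ''own'' (var ''b'')))
       (Seq (Assign ''own'' (var ''b'') (var ''pend''))
         (Seq (set_var ''pend'' (var ''tmp''))
           (Assign ''lev'' (var ''b'') (Plus (Get ''lev'' (var ''b'')) (N 1))))))
     (set_var ''pend'' (N 0))"

definition bid :: com where
  "bid = Seq (set_var ''pend'' (Plus (var ''i'') (N 1)))
     (While (nonzero (var ''pend'')) (Seq find_best take_best))"

definition auction :: com where
  "auction = For ''i'' (If (nonzero (Get ''S'' (var ''i''))) (Seq bid bid) Skip)"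

definition mark :: com where
  "mark = Seq (Seq (set_var ''k'' (N 0)) (set_var ''m'' (N 0))) (For ''i''
     (If (nonzero (Get ''S'' (var ''i'')))
       (Seq (Assign ''outV'' (var ''i'') (N 1)) (set_var ''k'' (Plus (var ''k'') (N 1))))
       (If (nonzero (Get ''own'' (var ''i'')))
         (Seq (Assign ''outV'' (var ''i'') (N 1)) (set_var ''m'' (Plus (var ''m'') (N 1))))
         (Assign ''outV'' (var ''i'') (N 0)))))"

text \<open>Later conditionals overwrite earlier ones, so the last test, for
  \<open>n <= 3 * k\<close>, has the highest priority, as in \<open>target\<close>.\<close>

definition set_target :: com where
  "set_target = Seq (set_var ''g'' (Plus (var ''k'') (var ''k'')))
     (Seq (If (And (Eq (var ''k'') (N 1)) (Not (Eq (var ''m'') (N 2)))) (set_var ''g'' (N 1)) Skip)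
     (Seq (If (And (Eq (var ''k'') (N 2)) (Eq (var ''m'') (N 2))) (set_var ''g'' (N 3)) Skip)
       (If (Less (Plus (var ''k'') (Plus (var ''k'') (var ''k''))) (var ''n'')) Skip
         (set_var ''g'' (var ''n'')))))"

definition fill :: com where
  "fill = For ''i''
     (If (And (Eq (Get ''outV'' (var ''i'')) (N 0)) (Less (var ''m'') (var ''g'')))
       (Seq (Assign ''outV'' (var ''i'') (N 1)) (set_var ''m'' (Plus (var ''m'') (N 1)))) Skip)"

definition emit :: com where
  "emit = For ''i'' (For ''j''
     (If (And (nonzero (Get ''outV'' (var ''i''))) (nonzero (Get ''outV'' (var ''j''))))
       (Assign ''outE'' (Plus (Get ''row'' (var ''i'')) (var ''j''))
         (Get ''E'' (Plus (Get ''row'' (var ''i'')) (var ''j''))))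
       (Assign ''outE'' (Plus (Get ''row'' (var ''i'')) (var ''j'')) (N 0))))"

definition kernelize :: com where
  "kernelize = Seq init_rows (Seq auction (Seq mark (Seq set_target (Seq fill emit))))"

text \<open>
  The size of the clique part of the kernel, for \<open>k = card S\<close> and \<open>m\<close> owned clique vertices. Two
  clique vertices outside all other cycles do not form a cycle; for \<open>k \<le> 2\<close> the size \<open>2 * k\<close>
  could leave such a pair.
\<close>

definition target :: "nat \<Rightarrow> nat \<Rightarrow> nat \<Rightarrow> nat" where
  "target n k m = (if n \<le> 3 * k then n else if k = 1 \<and> m \<noteq> 2 then 1
     else if k = 2 \<and> m = 2 then 3 else 2 * k)"

text \<open>Uniqueness of quotient and remainder; hence writing one matrix entry leaves the others
  intact.\<close>

lemma row_index_eq: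
  fixes u v i j n :: nat
  assumes "v < n" "j < n"
  shows "u * n + v = i * n + j \<longleftrightarrow> u = i \<and> v = j"
proof
  assume eq: "u * n + v = i * n + j"
  have "u = (u * n + v) div n" "i = (i * n + j) div n" using assms by auto
  then have "u = i" using eq by metis
  then show "u = i \<and> v = j" using eq by simp
qed simp

section \<open>Correctness and running time of the program\<close>

context assignment
begin

text \<open>The data that no phase after \<open>init_rows\<close> overwrites.\<close>

definition ctxt :: "store \<Rightarrow> bool" where
  "ctxt s \<longleftrightarrow> s ''n'' 0 = n \<and> (\<forall>v<n. s ''S'' v = (if v \<in> S then 1 else 0)) \<and>
     (\<forall>u<n. \<forall>v<n. s ''E'' (u * n + v) = (if E u v then 1 else 0)) \<and> (\<forall>u<n. s ''row'' u = u * n)"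

lemma ctxt_upd [simp]:
  "x \<notin> {''n'', ''S'', ''E'', ''row''} \<Longrightarrow> ctxt (s(x := f)) \<longleftrightarrow> ctxt s"
  unfolding ctxt_def by auto

lemma ctxtD:
  "ctxt s \<Longrightarrow> s ''n'' 0 = n"
  "ctxt s \<Longrightarrow> v < n \<Longrightarrow> s ''S'' v = (if v \<in> S then 1 else 0)"
  "ctxt s \<Longrightarrow> u < n \<Longrightarrow> v < n \<Longrightarrow> s ''E'' (u * n + v) = (if E u v then 1 else 0)"
  "ctxt s \<Longrightarrow> u < n \<Longrightarrow> s ''row'' u = u * n"
  by (simp_all add: ctxt_def)

definition input :: "store \<Rightarrow> bool" where
  "input s \<longleftrightarrow> s ''n'' 0 = n \<and> (\<forall>v<n. s ''S'' v = (if v \<in> S then 1 else 0)) \<and>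
     (\<forall>u<n. \<forall>v<n. s ''E'' (u * n + v) = (if E u v then 1 else 0)) \<and>
     s ''lev'' = (\<lambda>_. 0) \<and> s ''own'' = (\<lambda>_. 0)"

definition auctioning :: "(nat \<Rightarrow> nat) \<Rightarrow> nat \<Rightarrow> store \<Rightarrow> bool" where
  "auctioning T p s \<longleftrightarrow> ctxt s \<and> prices (s ''lev'') (s ''own'') \<and> served (s ''lev'') (s ''own'') p T"

lemma auctioning_upd [simp]:
  "x \<notin> {''n'', ''S'', ''E'', ''row'', ''lev'', ''own''} \<Longrightarrow>
    auctioning T p (s(x := f)) \<longleftrightarrow> auctioning T p s"
  unfolding auctioning_def by auto

lemma init_rows_total:
  "total input init_rows (1 + (n * (1 + 2) + 2)) (auctioning (\<lambda>_. 0) 0)"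
proof -
  \<comment> \<open>Iteration \<open>i\<close> writes entry \<open>i + 1\<close>, so the range
    includes \<open>i\<close> itself.\<close>
  let ?I = "\<lambda>i s. input s \<and> (\<forall>u\<le>i. s ''row'' u = u * n)"
  have "total input (Assign ''row'' (N 0) (N 0)) 1 (?I 0)"
    by (rule total_loop_free) (auto simp: input_def)
  moreover have "total (?I 0) (For ''i''
      (Assign ''row'' (Plus (var ''i'') (N 1)) (Plus (Get ''row'' (var ''i'')) (var ''n''))))
      (n * (1 + 2) + 2) (?I n)"
    by (rule total_For, rule total_loop_free) (auto simp: input_def le_Suc_eq)
  ultimately have "total input init_rows (1 + (n * (1 + 2) + 2)) (?I n)"
    unfolding init_rows_def by (rule total_Seq)
  then show ?thesis
  proof (rule total_conseq)
    fix s assume s: "?I n s"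
    have "prices (\<lambda>_. 0) (\<lambda>_. 0)" "served (\<lambda>_. 0) (\<lambda>_. 0) 0 (\<lambda>_. 0)"
      by (auto simp: prices_def served_def holds_def)
    then show "auctioning (\<lambda>_. 0) 0 s"
      using s by (auto simp: auctioning_def input_def ctxt_def)
  qed
qed

definition best_upto :: "nat \<Rightarrow> nat \<Rightarrow> store \<Rightarrow> bool" where
  "best_upto p j s \<longleftrightarrow> s ''l'' 0 \<le> n \<and> (\<forall>c<j. nbr p c \<longrightarrow> s ''l'' 0 \<le> s ''lev'' c) \<and>
     (s ''l'' 0 < n \<longrightarrow> nbr p (s ''b'' 0) \<and> s ''lev'' (s ''b'' 0) = s ''l'' 0)"

text \<open>\<open>w\<close> freezes the total price before the bid, as the reference value for the
  decrease of \<open>remaining\<close>.\<close>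

definition bidding :: "(nat \<Rightarrow> nat) \<Rightarrow> nat \<Rightarrow> nat \<Rightarrow> nat \<Rightarrow> store \<Rightarrow> bool" where
  "bidding T i p w s \<longleftrightarrow> auctioning T (Suc p) s \<and> s ''pend'' 0 = Suc p \<and> s ''i'' 0 = i \<and> p \<in> S \<and>
     (\<Sum>c<n. s ''lev'' c) = w"

lemma bidding_upd [simp]:
  "x \<notin> {''n'', ''S'', ''E'', ''row'', ''lev'', ''own'', ''pend'', ''i''} \<Longrightarrow>
    bidding T i p w (s(x := f)) \<longleftrightarrow> bidding T i p w s"
  unfolding bidding_def by auto

lemma find_best_total:
  "total (bidding T i p w) find_best (1 + (n * (4 + 2) + 2)) (\<lambda>s. bidding T i p w s \<and> best_upto p n s)"
proof -
  let ?I = "\<lambda>j s. bidding T i p w s \<and> best_upto p j s"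
  have "total (bidding T i p w) (set_var ''l'' (var ''n'')) 1 (?I 0)"
    by (rule total_loop_free) (auto simp: best_upto_def bidding_def auctioning_def ctxt_def)
  moreover have "total (?I 0) (For ''j''
     (If (And (Eq (Get ''S'' (var ''j'')) (N 0))
           (And (nonzero (Get ''E'' (Plus (Get ''row'' (Minus (var ''pend'') (N 1))) (var ''j''))))
             (Less (Get ''lev'' (var ''j'')) (var ''l''))))
       (Seq (set_var ''b'' (var ''j'')) (set_var ''l'' (Get ''lev'' (var ''j''))))
       Skip)) (n * (4 + 2) + 2) (?I n)"
    (is "total _ (For _ ?body) _ _")
  proof (rule total_For)
    fix j assume j: "j < n"
    show "total (\<lambda>s. ?I j s \<and> s ''j'' 0 = j) ?body 4 (\<lambda>s. ?I (Suc j) s \<and> s ''j'' 0 = j)"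
    proof (rule total_loop_free)
      fix s assume s: "?I j s \<and> s ''j'' 0 = j"
      have p: "p < n" using s S_sub by (auto simp: bidding_def)
      have c: "ctxt s" "s ''pend'' 0 = Suc p" using s by (auto simp: bidding_def auctioning_def)
      have "nbr p j \<longleftrightarrow> s ''S'' j = 0 \<and> 0 < s ''E'' (s ''row'' p + j)"
        using ctxtD[OF c(1)] j p by (simp add: nbr_def)
      then show "?I (Suc j) (result ?body s) \<and> result ?body s ''j'' 0 = j"
        using s c j by (auto simp: best_upto_def less_Suc_eq)
    qed simp_all
  next
    fix j s assume "?I j s"
    then show "s ''n'' 0 = n" by (auto simp: bidding_def auctioning_def ctxt_def)
    fix v from \<open>?I j s\<close> show "?I j (s(''j'' := (s ''j'')(0 := v)))" by (simp add: best_upto_def)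
  qed simp
  ultimately show ?thesis unfolding find_best_def by (rule total_Seq)
qed

definition bid_inv :: "(nat \<Rightarrow> nat) \<Rightarrow> nat \<Rightarrow> store \<Rightarrow> bool" where
  "bid_inv T i s \<longleftrightarrow> auctioning T (s ''pend'' 0) s \<and> s ''i'' 0 = i"

text \<open>Variant of the bidding loop: a successful bid raises the total price, and giving up
  clears \<open>pend\<close>. The \<open>Suc\<close> makes giving up a strict decrease even if the
  total price is already \<open>n * n\<close>.\<close>

definition remaining :: "store \<Rightarrow> nat" where
  "remaining s = (if s ''pend'' 0 = 0 then 0 else Suc (n * n - (\<Sum>c<n. s ''lev'' c)))"

lemma take_best_total:
  "total (\<lambda>s. bidding T i p w s \<and> best_upto p n s) take_best 6
    (\<lambda>s. bid_inv T i s \<and> remaining s < Suc (n * n - w))"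
proof (rule total_loop_free)
  fix s assume s: "bidding T i p w s \<and> best_upto p n s"
  let ?lev = "s ''lev''" and ?own = "s ''own''" and ?b = "s ''b'' 0"
  have inv: "ctxt s" "prices ?lev ?own" "served ?lev ?own (Suc p) T" "p \<in> S" "s ''pend'' 0 = Suc p"
      "s ''i'' 0 = i" "(\<Sum>c<n. ?lev c) = w" "s ''n'' 0 = n"
    using s ctxtD by (auto simp: bidding_def auctioning_def)
  show "bid_inv T i (result take_best s) \<and> remaining (result take_best s) < Suc (n * n - w)"
  proof (cases "s ''l'' 0 < n")
    case False
    then have "\<And>c. nbr p c \<Longrightarrow> n \<le> ?lev c"
      using s by (auto simp: best_upto_def nbr_def intro: le_trans)
    then have "served ?lev ?own 0 T" using served_give_up inv by blast
    then show ?thesis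
      using inv False by (simp add: take_best_def bid_inv_def auctioning_def remaining_def)
  next
    case True
    then have b: "nbr p ?b" "?lev ?b < n" "\<And>c. nbr p c \<Longrightarrow> ?lev ?b \<le> ?lev c"
      using s by (auto simp: best_upto_def nbr_def)
    then have "?b < n" by (simp add: nbr_def)
    let ?lev' = "?lev(?b := Suc (?lev ?b))" and ?own' = "?own(?b := Suc p)"
    have step: "prices ?lev' ?own'" "served ?lev' ?own' (?own ?b) T"
      using prices_step[OF inv(2,4) b] served_step[OF inv(2,3) \<open>?b < n\<close>] by simp_all
    have sum: "(\<Sum>c<n. ?lev' c) = Suc w"
      using sum_prices_step[OF \<open>?b < n\<close>, of ?lev] inv by simp
    \<comment> \<open>The bound on the new prices ensures that the truncated difference
      \<open>n * n - w\<close> is positive and really drops.\<close>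
    then have "Suc w \<le> n * n" using sum_prices_le[OF step(1)] by simp
    define s' where "s' = result take_best s"
    have s': "s' ''lev'' = ?lev'" "s' ''own'' = ?own'" "s' ''pend'' 0 = ?own ?b" "s' ''i'' 0 = i"
        "ctxt s'"
      using True inv by (simp_all add: s'_def take_best_def)
    have "bid_inv T i s'" using step s' by (simp add: bid_inv_def auctioning_def)
    moreover have "remaining s' < Suc (n * n - w)"
      using sum \<open>Suc w \<le> n * n\<close> unfolding remaining_def s' by (auto split: if_splits)
    ultimately show ?thesis by (simp add: s'_def)
  qed
qed (simp_all add: take_best_def)

text \<open>The factor \<open>n * n + 1\<close> is the largest value of \<open>remaining\<close> and
  so bounds the number of iterations.\<close>

abbreviation bid_time :: nat where
  "bid_time \<equiv> 1 + ((n * n + 1) * (1 + (n * (4 + 2) + 2) + 6 + 1) + 1)"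

lemma bid_total:
  assumes "i \<in> S"
  shows "total (\<lambda>s. auctioning T 0 s \<and> s ''i'' 0 = i) bid bid_time
    (\<lambda>s. auctioning (T(i := Suc (T i))) 0 s \<and> s ''i'' 0 = i)"
proof -
  let ?T = "T(i := Suc (T i))"
  have "total (\<lambda>s. bid_inv ?T i s \<and> bval (nonzero (var ''pend'')) s \<and> remaining s = k)
      (Seq find_best take_best) (1 + (n * (4 + 2) + 2) + 6) (\<lambda>s. bid_inv ?T i s \<and> remaining s < k)" for k
  proof -
    \<comment> \<open>Bidder and total price change between iterations, so they are quantified in
      the precondition and fixed only within one iteration.\<close>
    have "total (\<lambda>s. \<exists>p w. bidding ?T i p w s \<and> k = Suc (n * n - w)) (Seq find_best take_best)
        (1 + (n * (4 + 2) + 2) + 6) (\<lambda>s. bid_inv ?T i s \<and> remaining s < k)"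
    proof (intro total_Ex)
      fix p w
      have "total (bidding ?T i p w) (Seq find_best take_best) (1 + (n * (4 + 2) + 2) + 6)
          (\<lambda>s. bid_inv ?T i s \<and> remaining s < Suc (n * n - w))"
        by (rule total_Seq[OF find_best_total take_best_total])
      then show "total (\<lambda>s. bidding ?T i p w s \<and> k = Suc (n * n - w)) (Seq find_best take_best)
          (1 + (n * (4 + 2) + 2) + 6) (\<lambda>s. bid_inv ?T i s \<and> remaining s < k)"
        unfolding total_def by blast
    qed
    then show ?thesis
    proof (rule total_conseq)
      fix s assume s: "bid_inv ?T i s \<and> bval (nonzero (var ''pend'')) s \<and> remaining s = k"
      then obtain p where p: "s ''pend'' 0 = Suc p" using gr0_conv_Suc by auto
      then have "p \<in> S" using s by (auto simp: bid_inv_def auctioning_def served_def)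
      then have "bidding ?T i p (\<Sum>c<n. s ''lev'' c) s" "k = Suc (n * n - (\<Sum>c<n. s ''lev'' c))"
        using s p by (auto simp: bidding_def bid_inv_def remaining_def)
      then show "\<exists>p w. bidding ?T i p w s \<and> k = Suc (n * n - w)" by blast
    qed
  qed
  then have "total (bid_inv ?T i) (While (nonzero (var ''pend'')) (Seq find_best take_best))
      ((n * n + 1) * (1 + (n * (4 + 2) + 2) + 6 + 1) + 1)
      (\<lambda>s. bid_inv ?T i s \<and> \<not> bval (nonzero (var ''pend'')) s)"
    by (rule total_While) (auto simp: remaining_def)
  then have loop: "total (bid_inv ?T i) (While (nonzero (var ''pend'')) (Seq find_best take_best))
      ((n * n + 1) * (1 + (n * (4 + 2) + 2) + 6 + 1) + 1)
      (\<lambda>s. auctioning ?T 0 s \<and> s ''i'' 0 = i)"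
    by (rule total_conseq) (auto simp: bid_inv_def)
  have "total (\<lambda>s. auctioning T 0 s \<and> s ''i'' 0 = i) (set_var ''pend'' (Plus (var ''i'') (N 1))) 1
      (bid_inv ?T i)"
    by (rule total_loop_free) (use assms in \<open>auto simp: bid_inv_def auctioning_def intro: served_start\<close>)
  from total_Seq[OF this loop] show ?thesis by (simp only: bid_def)
qed

lemma auction_total:
  "total (auctioning (\<lambda>_. 0) 0) auction (n * (bid_time + bid_time + 1 + 2) + 2) (auctioning (\<lambda>_. 2) 0)"
proof -
  \<comment> \<open>Vertices below \<open>i\<close> have asked for two, the others for none. Since
    \<open>served\<close> evaluates \<open>T\<close> on \<open>S\<close> only, indices outside
    \<open>S\<close> can be counted uniformly.\<close>
  define T where "T = (\<lambda>i s :: nat. if s < i then 2 else 0 :: nat)"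
  have T_Suc: "(T i)(i := Suc (T i i), i := Suc (((T i)(i := Suc (T i i))) i)) = T (Suc i)" for i
    by (auto simp: T_def less_Suc_eq fun_eq_iff)
  have "total (auctioning (T 0) 0) auction (n * (bid_time + bid_time + 1 + 2) + 2) (auctioning (T n) 0)"
    unfolding auction_def
  proof (rule total_For)
    fix i assume i: "i < n"
    show "total (\<lambda>s. auctioning (T i) 0 s \<and> s ''i'' 0 = i)
        (If (nonzero (Get ''S'' (var ''i''))) (Seq bid bid) Skip) (bid_time + bid_time + 1)
        (\<lambda>s. auctioning (T (Suc i)) 0 s \<and> s ''i'' 0 = i)"
    proof (rule total_If)
      show "total (\<lambda>s. (auctioning (T i) 0 s \<and> s ''i'' 0 = i) \<and> bval (nonzero (Get ''S'' (var ''i''))) s)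
          (Seq bid bid) (bid_time + bid_time) (\<lambda>s. auctioning (T (Suc i)) 0 s \<and> s ''i'' 0 = i)"
      proof (cases "i \<in> S")
        case True
        have "total (\<lambda>s. auctioning (T i) 0 s \<and> s ''i'' 0 = i) (Seq bid bid) (bid_time + bid_time)
            (\<lambda>s. auctioning (T (Suc i)) 0 s \<and> s ''i'' 0 = i)"
          using total_Seq[OF bid_total[OF True] bid_total[OF True], of "T i"] unfolding T_Suc .
        then show ?thesis by (rule total_conseq) auto
      next
        case False
        then show ?thesis
          using i by (auto simp: total_def auctioning_def ctxtD)
      qed
      show "total (\<lambda>s. (auctioning (T i) 0 s \<and> s ''i'' 0 = i) \<and> \<not> bval (nonzero (Get ''S'' (var ''i''))) s)
          Skip (bid_time + bid_time) (\<lambda>s. auctioning (T (Suc i)) 0 s \<and> s ''i'' 0 = i)"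
      proof (rule total_loop_free)
        fix s assume s: "(auctioning (T i) 0 s \<and> s ''i'' 0 = i) \<and> \<not> bval (nonzero (Get ''S'' (var ''i''))) s"
        then have "i \<notin> S" using i by (auto simp: auctioning_def ctxtD)
        then have "served lev own 0 (T (Suc i)) = served lev own 0 (T i)" for lev own
          unfolding served_def T_def by (intro conj_cong refl ball_cong) (auto simp: less_Suc_eq)
        then show "auctioning (T (Suc i)) 0 (result Skip s) \<and> result Skip s ''i'' 0 = i"
          using s by (simp add: auctioning_def)
      qed simp_all
    qed
  next
    fix i s v assume s: "auctioning (T i) 0 s"
    then show "auctioning (T i) 0 (s(''i'' := (s ''i'')(0 := v)))" by simp
    show "s ''n'' 0 = n" using s by (simp add: auctioning_def ctxtD(1))
  qed simp
  then show ?thesis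
  proof (rule total_conseq)
    fix s
    show "auctioning (\<lambda>_. 0) 0 s \<Longrightarrow> auctioning (T 0) 0 s" by (simp add: T_def)
    have "served lev own 0 (T n) = served lev own 0 (\<lambda>_. 2)" for lev own
      unfolding served_def T_def using S_sub by (intro conj_cong refl ball_cong) auto
    then show "auctioning (T n) 0 s \<Longrightarrow> auctioning (\<lambda>_. 2) 0 s" by (simp add: auctioning_def)
  qed
qed

lemma finite_S: "finite S"
  using S_sub finite_subset by blast

definition owned :: "nat set \<Rightarrow> store \<Rightarrow> bool" where
  "owned M s \<longleftrightarrow> (\<forall>c<n. s ''own'' c \<noteq> 0 \<longleftrightarrow> c \<in> M)"

definition outputs :: "nat set \<Rightarrow> store \<Rightarrow> bool" where
  "outputs K s \<longleftrightarrow> (\<forall>v<n. s ''outV'' v = (if v \<in> S \<union> K then 1 else 0))"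

lemma mark_total:
  assumes M: "M \<subseteq> {..<n} - S"
  shows "total (\<lambda>s. ctxt s \<and> owned M s) mark (2 + (n * (7 + 2) + 2))
    (\<lambda>s. ctxt s \<and> outputs M s \<and> s ''k'' 0 = card S \<and> s ''m'' 0 = card M)"
proof -
  let ?I = "\<lambda>i s. ctxt s \<and> owned M s \<and> (\<forall>v<i. s ''outV'' v = (if v \<in> S \<union> M then 1 else 0)) \<and>
    s ''k'' 0 = card (S \<inter> {..<i}) \<and> s ''m'' 0 = card (M \<inter> {..<i})"
  have step: "card (X \<inter> {..<Suc i}) = card (X \<inter> {..<i}) + (if i \<in> X then 1 else 0)" for X :: "nat set" and i
    by (simp add: lessThan_Suc Int_insert_right)
  have "total (\<lambda>s. ctxt s \<and> owned M s) (Seq (set_var ''k'' (N 0)) (set_var ''m'' (N 0))) 2 (?I 0)"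
    by (rule total_loop_free) (auto simp: owned_def)
  moreover have "total (?I 0) (For ''i''
     (If (nonzero (Get ''S'' (var ''i'')))
       (Seq (Assign ''outV'' (var ''i'') (N 1)) (set_var ''k'' (Plus (var ''k'') (N 1))))
       (If (nonzero (Get ''own'' (var ''i'')))
         (Seq (Assign ''outV'' (var ''i'') (N 1)) (set_var ''m'' (Plus (var ''m'') (N 1))))
         (Assign ''outV'' (var ''i'') (N 0))))) (n * (7 + 2) + 2) (?I n)"
    (is "total _ (For _ ?body) _ _")
  proof (rule total_For)
    fix i assume i: "i < n"
    show "total (\<lambda>s. ?I i s \<and> s ''i'' 0 = i) ?body 7 (\<lambda>s. ?I (Suc i) s \<and> s ''i'' 0 = i)"
    proof (rule total_loop_free)
      fix s assume s: "?I i s \<and> s ''i'' 0 = i"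
      then have "s ''S'' i = (if i \<in> S then 1 else 0)" "(0 < s ''own'' i) = (i \<in> M)"
        using ctxtD(2) i by (auto simp: owned_def)
      then show "?I (Suc i) (result ?body s) \<and> result ?body s ''i'' 0 = i"
        using s M unfolding step by (auto simp: owned_def less_Suc_eq)
    qed simp_all
  next
    fix i s v assume s: "?I i s"
    then show "?I i (s(''i'' := (s ''i'')(0 := v)))" by (simp add: owned_def)
    show "s ''n'' 0 = n" using s by (simp add: ctxtD(1))
  qed simp
  ultimately have "total (\<lambda>s. ctxt s \<and> owned M s) mark (2 + (n * (7 + 2) + 2)) (?I n)"
    unfolding mark_def by (rule total_Seq)
  then show ?thesis
  proof (rule total_conseq)
    fix s assume "?I n s"
    moreover have "S \<inter> {..<n} = S" "M \<inter> {..<n} = M" using S_sub M by auto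
    ultimately show "ctxt s \<and> outputs M s \<and> s ''k'' 0 = card S \<and> s ''m'' 0 = card M"
      by (simp add: outputs_def)
  qed
qed

lemma set_target_total:
  "total (\<lambda>s. ctxt s \<and> outputs M s \<and> s ''k'' 0 = k \<and> s ''m'' 0 = m) set_target 10
    (\<lambda>s. ctxt s \<and> outputs M s \<and> s ''m'' 0 = m \<and> s ''g'' 0 = target n k m)"
proof (rule total_loop_free)
  fix s assume "ctxt s \<and> outputs M s \<and> s ''k'' 0 = k \<and> s ''m'' 0 = m"
  then show "ctxt (result set_target s) \<and> outputs M (result set_target s) \<and>
      result set_target s ''m'' 0 = m \<and> result set_target s ''g'' 0 = target n k m"
    using ctxtD(1)[of s] by (auto simp: set_target_def target_def outputs_def)
qed (simp_all add: set_target_def)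

text \<open>For \<open>i = n\<close> the last conjunct says that a size below \<open>g\<close>
  occurs only if all clique vertices were taken, so that nothing was removed.\<close>

definition filled :: "nat set \<Rightarrow> nat \<Rightarrow> nat \<Rightarrow> nat set \<Rightarrow> bool" where
  "filled M g i K \<longleftrightarrow> M \<subseteq> K \<and> K \<subseteq> {..<n} - S \<and> card K \<le> g \<and> (card K < g \<longrightarrow> {..<i} - S \<subseteq> K)"

lemma fill_total:
  assumes M: "M \<subseteq> {..<n} - S" "card M \<le> g"
  shows "total (\<lambda>s. ctxt s \<and> outputs M s \<and> s ''m'' 0 = card M \<and> s ''g'' 0 = g) fill (n * (4 + 2) + 2)
    (\<lambda>s. ctxt s \<and> (\<exists>K. outputs K s \<and> filled M g n K))"
proof -
  let ?I = "\<lambda>i s. ctxt s \<and> s ''g'' 0 = g \<and> (\<exists>K. outputs K s \<and> s ''m'' 0 = card K \<and> filled M g i K)"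
  have "total (?I 0) fill (n * (4 + 2) + 2) (?I n)"
    unfolding fill_def
  proof (rule total_For)
    fix i assume i: "i < n"
    let ?body = "If (And (Eq (Get ''outV'' (var ''i'')) (N 0)) (Less (var ''m'') (var ''g'')))
       (Seq (Assign ''outV'' (var ''i'') (N 1)) (set_var ''m'' (Plus (var ''m'') (N 1)))) Skip"
    show "total (\<lambda>s. ?I i s \<and> s ''i'' 0 = i) ?body 4 (\<lambda>s. ?I (Suc i) s \<and> s ''i'' 0 = i)"
    proof (rule total_loop_free)
      fix s assume s: "?I i s \<and> s ''i'' 0 = i"
      then obtain K where K: "outputs K s" "s ''m'' 0 = card K" "filled M g i K" by blast
      have out: "(s ''outV'' i = 0) = (i \<notin> S \<union> K)" using K(1) i by (simp add: outputs_def)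
      show "?I (Suc i) (result ?body s) \<and> result ?body s ''i'' 0 = i"
      proof (cases "i \<notin> S \<union> K \<and> card K < g")
        case True
        have "finite K" using K(3) finite_subset by (auto simp: filled_def)
        then have "card (insert i K) = Suc (card K)" using True by simp
        moreover have "filled M g (Suc i) (insert i K)"
          using K(3) True i calculation by (auto simp: filled_def less_Suc_eq)
        moreover have "outputs (insert i K) (result ?body s)"
          using s K out True by (auto simp: outputs_def)
        ultimately show ?thesis
          using s K out True by (intro conjI exI[of _ "insert i K"]) auto
      next
        case False
        then have "filled M g (Suc i) K" using K(3) by (auto simp: filled_def less_Suc_eq)
        then show ?thesis using s K out False by auto
      qed
    qed simp_all
  next
    fix i s v assume s: "?I i s"
    then show "?I i (s(''i'' := (s ''i'')(0 := v)))" by (simp add: outputs_def)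
    show "s ''n'' 0 = n" using s by (simp add: ctxtD(1))
  qed simp
  then show ?thesis
  proof (rule total_conseq)
    fix s assume "ctxt s \<and> outputs M s \<and> s ''m'' 0 = card M \<and> s ''g'' 0 = g"
    then show "?I 0 s" using M by (intro conjI exI[of _ M]) (auto simp: filled_def)
  qed blast
qed

lemma emit_total:
  "total (\<lambda>s. ctxt s \<and> outputs K s) emit (n * (n * (3 + 2) + 2 + 2) + 2)
    (\<lambda>s. outputs K s \<and> (\<forall>u<n. \<forall>v<n. s ''outE'' (u * n + v) \<noteq> 0 \<longleftrightarrow>
       u \<in> S \<union> K \<and> v \<in> S \<union> K \<and> E u v))"
proof -
  let ?ok = "\<lambda>s u v. s ''outE'' (u * n + v) \<noteq> (0::nat) \<longleftrightarrow> u \<in> S \<union> K \<and> v \<in> S \<union> K \<and> E u v"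
  let ?I = "\<lambda>i s. ctxt s \<and> outputs K s \<and> (\<forall>u<i. \<forall>v<n. ?ok s u v)"
  have "total (?I 0) emit (n * (n * (3 + 2) + 2 + 2) + 2) (?I n)"
    unfolding emit_def
  proof (rule total_For)
    fix i assume i: "i < n"
    let ?body = "If (And (nonzero (Get ''outV'' (var ''i''))) (nonzero (Get ''outV'' (var ''j''))))
       (Assign ''outE'' (Plus (Get ''row'' (var ''i'')) (var ''j''))
         (Get ''E'' (Plus (Get ''row'' (var ''i'')) (var ''j''))))
       (Assign ''outE'' (Plus (Get ''row'' (var ''i'')) (var ''j'')) (N 0))"
    let ?J = "\<lambda>j s. ?I i s \<and> s ''i'' 0 = i \<and> (\<forall>v<j. ?ok s i v)"
    have "total (?J 0) (For ''j'' ?body) (n * (3 + 2) + 2) (?J n)"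
    proof (rule total_For)
      fix j assume j: "j < n"
      show "total (\<lambda>s. ?J j s \<and> s ''j'' 0 = j) ?body 3 (\<lambda>s. ?J (Suc j) s \<and> s ''j'' 0 = j)"
      proof (rule total_loop_free)
        fix s assume s: "?J j s \<and> s ''j'' 0 = j"
        then have c: "ctxt s" "outputs K s" "s ''i'' 0 = i" "s ''j'' 0 = j" by blast+
        define s' where "s' = result ?body s"
        define e where "e = (if i \<in> S \<union> K \<and> j \<in> S \<union> K \<and> E i j then 1 else 0 :: nat)"
        have s': "s' = s(''outE'' := (s ''outE'')(i * n + j := e))"
          using c ctxtD[OF c(1)] i j by (auto simp: s'_def e_def outputs_def)
        have "?ok s' u v" if "u < i \<and> v < n \<or> u = i \<and> v < Suc j" for u v
        proof (cases "u = i \<and> v = j")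
          case True
          then show ?thesis by (simp add: s' e_def)
        next
          case False
          then have "u * n + v \<noteq> i * n + j" using that j by (subst row_index_eq) auto
          then have "s' ''outE'' (u * n + v) = s ''outE'' (u * n + v)" by (simp add: s')
          moreover have "?ok s u v" using s that False by (auto simp: less_Suc_eq)
          ultimately show ?thesis by simp
        qed
        moreover have "ctxt s'" "outputs K s'" "s' ''i'' 0 = i" "s' ''j'' 0 = j"
          using c by (simp_all add: s' outputs_def)
        ultimately show "?J (Suc j) (result ?body s) \<and> result ?body s ''j'' 0 = j"
          unfolding s'_def[symmetric] by blast
      qed simp_all
    next
      fix j s v assume s: "?J j s"
      then show "?J j (s(''j'' := (s ''j'')(0 := v)))" by (simp add: outputs_def)
      show "s ''n'' 0 = n" using s by (simp add: ctxtD(1))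
    qed simp
    then show "total (\<lambda>s. ?I i s \<and> s ''i'' 0 = i) (For ''j'' ?body) (n * (3 + 2) + 2)
        (\<lambda>s. ?I (Suc i) s \<and> s ''i'' 0 = i)"
    proof (rule total_conseq)
      fix s
      show "?I i s \<and> s ''i'' 0 = i \<Longrightarrow> ?J 0 s" by blast
      assume "?J n s"
      then show "?I (Suc i) s \<and> s ''i'' 0 = i" unfolding less_Suc_eq by blast
    qed
  next
    fix i s v assume s: "?I i s"
    then show "?I i (s(''i'' := (s ''i'')(0 := v)))" by (simp add: outputs_def)
    show "s ''n'' 0 = n" using s by (simp add: ctxtD(1))
  qed simp
  then show ?thesis by (rule total_conseq) auto
qed

text \<open>Filling only adds vertices, so the owned ones must fit. By \<open>card_owned_le\<close>
  there are at most \<open>2 * card S\<close>; in the two exceptional cases this leaves at most 1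
  and exactly 2 owned vertices, against targets 1 and 3.\<close>

lemma target_ge:
  assumes "prices lev own" "served lev own 0 (\<lambda>_. 2)"
  shows "card {c. c < n \<and> own c \<noteq> 0} \<le> target n (card S) (card {c. c < n \<and> own c \<noteq> 0})"
proof -
  have "card {c. c < n \<and> own c \<noteq> 0} \<le> card {..<n}" by (intro card_mono) auto
  then show ?thesis using card_owned_le[OF assms] by (auto simp: target_def)
qed

abbreviation kernel_time :: nat where
  "kernel_time \<equiv> (1 + (n * (1 + 2) + 2)) + ((n * (bid_time + bid_time + 1 + 2) + 2) +
     ((2 + (n * (7 + 2) + 2)) + (10 + ((n * (4 + 2) + 2) + (n * (n * (3 + 2) + 2 + 2) + 2)))))"

text \<open>The prices merely certify the ownership and are quantified away.\<close>

definition good_own :: "(nat \<Rightarrow> nat) \<Rightarrow> bool" where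
  "good_own own \<longleftrightarrow> (\<exists>lev. prices lev own \<and> served lev own 0 (\<lambda>_. 2))"

definition kernelized :: "(nat \<Rightarrow> nat) \<Rightarrow> nat set \<Rightarrow> store \<Rightarrow> bool" where
  "kernelized own K s \<longleftrightarrow> good_own own \<and>
     filled {c. c < n \<and> own c \<noteq> 0} (target n (card S) (card {c. c < n \<and> own c \<noteq> 0})) n K \<and>
     outputs K s \<and> (\<forall>u<n. \<forall>v<n. s ''outE'' (u * n + v) \<noteq> 0 \<longleftrightarrow> u \<in> S \<union> K \<and> v \<in> S \<union> K \<and> E u v)"

lemma kernelize_total: "total input kernelize kernel_time (\<lambda>s. \<exists>own K. kernelized own K s)"
    (is "total _ _ _ ?post")
proof -
  let ?M = "\<lambda>own :: nat \<Rightarrow> nat. {c. c < n \<and> own c \<noteq> 0}"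
  let ?rest = "Seq mark (Seq set_target (Seq fill emit))"
  let ?time = "(2 + (n * (7 + 2) + 2)) + (10 + ((n * (4 + 2) + 2) + (n * (n * (3 + 2) + 2 + 2) + 2)))"
  \<comment> \<open>From here on the ownership is a fixed function instead of an array, since it
    determines the set and the target shared by several phases.\<close>
  have rest: "total (\<lambda>s. ctxt s \<and> owned (?M own) s) ?rest ?time ?post" if good: "good_own own" for own
  proof -
    obtain lev where lev: "prices lev own" "served lev own 0 (\<lambda>_. 2)"
      using good by (auto simp: good_own_def)
    let ?g = "target n (card S) (card (?M own))"
    have M: "?M own \<subseteq> {..<n} - S" using lev(1) by (auto simp: prices_def nbr_def gr0_conv_Suc)
    have emit: "total (\<lambda>s. ctxt s \<and> (\<exists>K. outputs K s \<and> filled (?M own) ?g n K)) emit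
        (n * (n * (3 + 2) + 2 + 2) + 2) ?post"
    proof -
      have "total (\<lambda>s. \<exists>K. (ctxt s \<and> outputs K s) \<and> filled (?M own) ?g n K) emit
          (n * (n * (3 + 2) + 2 + 2) + 2) ?post"
      proof (rule total_Ex)
        fix K
        show "total (\<lambda>s. (ctxt s \<and> outputs K s) \<and> filled (?M own) ?g n K) emit
          (n * (n * (3 + 2) + 2 + 2) + 2) ?post"
          by (rule total_conseq[OF total_conj[OF emit_total[of K]]])
            (assumption, use good in \<open>auto simp: kernelized_def\<close>)
      qed
      then show ?thesis by (rule total_conseq) blast+
    qed
    show ?thesis
      by (rule total_Seq[OF mark_total[OF M] total_Seq[OF set_target_total
            total_Seq[OF fill_total[OF M target_ge[OF lev]] emit]]])
  qed
  have "total (\<lambda>s. \<exists>own. (ctxt s \<and> owned (?M own) s) \<and> good_own own) ?rest ?time ?post"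
  proof (rule total_Ex)
    fix own
    show "total (\<lambda>s. (ctxt s \<and> owned (?M own) s) \<and> good_own own) ?rest ?time ?post"
      using rest[of own] unfolding total_def by blast
  qed
  then have "total (auctioning (\<lambda>_. 2) 0) ?rest ?time ?post"
  proof (rule total_conseq)
    fix s assume "auctioning (\<lambda>_. 2) 0 s"
    then show "\<exists>own. (ctxt s \<and> owned (?M own) s) \<and> good_own own"
      by (intro exI[of _ "s ''own''"]) (auto simp: auctioning_def owned_def good_own_def)
  qed
  then show ?thesis
    unfolding kernelize_def
    by (intro total_Seq[OF init_rows_total total_Seq[OF auction_total]])
qed

end

lemma kernel_time_poly: "poly_time assignment.kernel_time"
  by (intro poly_time_add poly_time_mult poly_time_const poly_time_id)

section \<open>The kernel\<close>

context assignment
begin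

text \<open>If \<open>K\<close> is the whole clique, the graph is unchanged. Otherwise
  \<open>K\<close> has exactly the target size and \<open>3 * card S < n\<close>; the cases of
  \<open>target\<close> then meet the numerical hypotheses of \<open>coverable_remove_clique\<close>
  and \<open>coverable_add_clique\<close>.\<close>

lemma kernel_correct:
  assumes split: "clique_split E S ({..<n} - S)" and good: "good_own own"
    and filled: "filled {c. c < n \<and> own c \<noteq> 0} (target n (card S) (card {c. c < n \<and> own c \<noteq> 0})) n K"
  shows "1 \<le> r \<Longrightarrow> clique_split.coverable E {..<n} r \<longleftrightarrow>
    clique_split.coverable E (S \<union> K) r" and "card (S \<union> K) \<le> 3 * card S"
proof -
  let ?C = "{..<n} - S" and ?M = "{c. c < n \<and> own c \<noteq> 0}"
  let ?g = "target n (card S) (card ?M)"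
  interpret clique_split E S ?C by (rule split)
  obtain lev where lev: "prices lev own" "served lev own 0 (\<lambda>_. 2)"
    using good by (auto simp: good_own_def)
  obtain A where A: "A \<subseteq> ?C" "?C - A \<subseteq> ?M"
    "\<And>s a. s \<in> S \<Longrightarrow> a \<in> A \<Longrightarrow> E s a \<Longrightarrow> \<exists>c1 c2. c1 \<in> A \<and> c2 \<in> A \<and> c1 \<noteq> c2 \<and>
       own c1 = Suc s \<and> own c2 = Suc s"
    using gap_structure[OF lev] by blast
  have own: "own c - 1 \<in> S \<and> nbr (own c - 1) c" if "c \<in> ?M" for c
    using that lev(1) by (auto simp: prices_def gr0_conv_Suc)
  interpret clique_reduction E S ?C A ?M "\<lambda>c. own c - 1"
  proof
    show "?M \<subseteq> ?C" using own by (auto simp: nbr_def)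
    fix s a assume "s \<in> S" "a \<in> A" "E s a"
    then obtain c1 c2 where c: "c1 \<in> A" "c2 \<in> A" "c1 \<noteq> c2" "own c1 = Suc s" "own c2 = Suc s"
      using A(3) by blast
    then show "\<exists>c1 c2. c1 \<in> A \<inter> ?M \<and> c2 \<in> A \<inter> ?M \<and> c1 \<noteq> c2 \<and> own c1 - 1 = s \<and> own c2 - 1 = s"
      using A(1) by (intro exI[of _ c1] exI[of _ c2]) auto
  qed (use A own in \<open>auto simp: nbr_def\<close>)
  have SC: "S \<union> ?C = {..<n}" using S_sub by auto
  have K: "?M \<subseteq> K" "K \<subseteq> ?C" "card K \<le> ?g" "card K < ?g \<Longrightarrow> K = ?C"
    using filled by (auto simp: filled_def)
  have card_C: "card ?C = n - card S" using S_sub finite_S by (simp add: card_Diff_subset)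
  have card_SK: "card (S \<union> K) = card S + card K"
    using K(2) finite_S finite_subset[of K ?C] by (intro card_Un_disjoint) auto
  have S0: "card S > 0" using S_nonempty finite_S by (simp add: card_gt_0_iff)
  have card_K: "card K \<le> n - card S" using card_mono[of ?C K] K(2) card_C by simp
  have le: "?g \<le> 2 * card S" if "3 * card S < n"
    using that S0 by (auto simp: target_def)
  have card_S: "card S \<le> n" using card_mono[of "{..<n}" S] S_sub by simp
  show "card (S \<union> K) \<le> 3 * card S"
    using card_SK card_K K(3) le card_S by linarith
  show "coverable {..<n} r \<longleftrightarrow> coverable (S \<union> K) r" if r: "1 \<le> r"
  proof (cases "K = ?C")
    case True
    then show ?thesis using SC by simp
  next
    case False
    then have gK: "card K = ?g" using K(3,4) by linarith
    have "card K < card ?C" using False K(2) by (intro psubset_card_mono) auto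
    \<comment> \<open>Otherwise the target would be \<open>n\<close>, which a proper subset of the
      clique cannot reach.\<close>
    then have n: "3 * card S < n" using gK by (auto simp: target_def card_C split: if_splits)
    have g: "card K = (if card S = 1 \<and> card ?M \<noteq> 2 then 1
        else if card S = 2 \<and> card ?M = 2 then 3 else 2 * card S)"
      using gK n by (simp add: target_def)
    show ?thesis
    proof
      assume "coverable {..<n} r"
      then have "coverable (S \<union> ?C) r" by (simp only: SC)
      then show "coverable (S \<union> K) r"
        by (intro coverable_remove_clique[OF K(1,2) S_nonempty _ _ _ _ r])
          (use g n card_C in \<open>auto split: if_splits\<close>)
    next
      assume "coverable (S \<union> K) r"
      then have "coverable (S \<union> ?C) r"
        by (intro coverable_add_clique[OF K(2) _ _ S_nonempty])
          (use g n card_C S0 in \<open>auto split: if_splits\<close>)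
      then show "coverable {..<n} r" by (simp only: SC)
    qed
  qed
qed

end

lemma input_store_E:
  assumes "u < n" "v < n"
  shows "input_store n G S ''E'' (u * n + v) = (if (u, v) \<in> parcs G then 1 else 0)"
proof -
  have "(\<exists>u'<n. \<exists>v'<n. u * n + v = u' * n + v' \<and> (u', v') \<in> parcs G) \<longleftrightarrow> (u, v) \<in> parcs G"
    using assms by (auto simp: row_index_eq)
  then show ?thesis by (simp add: input_store_def)
qed

theorem theorem2:
  shows "\<exists>(c :: com) (p :: nat poly).
    \<forall>(n :: nat) (G :: nat pair_pre_digraph) (S :: nat set).
      pair_graph G \<and> pverts G = {..<n} \<and> S \<noteq> {} \<and> S \<subseteq> pverts G \<and>
      K\<^bsub>card (pverts G - S)\<^esub> (with_proj G \<restriction> (pverts G - S)) \<longrightarrow>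
      (\<exists>t s. exec c (input_store n G S) t s \<and> t \<le> poly p n \<and>
        induced_subgraph (with_proj (output_graph n s)) (with_proj G) \<and>
        card (pverts (output_graph n s)) \<le> 3 * card S \<and>
        (\<forall>r::nat. 1 \<le> r \<longrightarrow>
          (has_cycle_cover_of_size_le (with_proj G) r \<longleftrightarrow>
           has_cycle_cover_of_size_le (with_proj (output_graph n s)) r)))"
proof -
  obtain p :: "nat poly" where p: "\<And>n. assignment.kernel_time n = poly p n"
    using kernel_time_poly unfolding poly_time_def by blast
  show ?thesis
  proof (rule exI[of _ kernelize], rule exI[of _ p], intro allI impI)
    fix n :: nat and G :: "nat pair_pre_digraph" and S :: "nat set"
    assume asm: "pair_graph G \<and> pverts G = {..<n} \<and> S \<noteq> {} \<and> S \<subseteq> pverts G \<and>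
      K\<^bsub>card (pverts G - S)\<^esub> (with_proj G \<restriction> (pverts G - S))"
    then interpret G: pair_graph G by simp
    have V: "pverts G = {..<n}" using asm by blast
    define E where "E = (\<lambda>u v. (u, v) \<in> parcs G)"
    interpret assignment n S E
      by unfold_locales (use asm V in auto)
    have split: "clique_split E S ({..<n} - S)"
    proof
      show "E u v \<Longrightarrow> E v u" for u v
        using G.pair_sym_arcs by (auto simp: E_def symmetric_def sym_def)
      fix u v assume uv: "u \<in> {..<n} - S" "v \<in> {..<n} - S" "u \<noteq> v"
      have "K\<^bsub>card (pverts G - S)\<^esub> (with_proj G \<restriction> (pverts G - S))" using asm by blast
      then have "arcs_ends (with_proj G \<restriction> (pverts G - S)) =
          {(u, v). (u, v) \<in> ({..<n} - S) \<times> ({..<n} - S) \<and> u \<noteq> v}"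
        unfolding V by (simp add: complete_digraph_def)
      then have "(u, v) \<in> arcs_ends (with_proj G \<restriction> (pverts G - S))" using uv by blast
      then show "E u v"
        by (auto simp: E_def arcs_ends_def arc_to_ends_def induce_subgraph_def)
    qed (use finite_S in auto)
    interpret clique_split E S "{..<n} - S" by (rule split)
    have inp: "input (input_store n G S)"
      unfolding input_def by (simp add: input_store_E E_def) (simp add: input_store_def)
    obtain t s where run: "exec kernelize (input_store n G S) t s" "t \<le> kernel_time"
      and post: "\<exists>own K. kernelized own K s"
      using totalE[OF kernelize_total, OF inp] by metis
    from post obtain own K where "kernelized own K s" by (elim exE)
    then have good: "good_own own" and out: "outputs K s"
      and filled: "filled {c. c < n \<and> own c \<noteq> 0} (target n (card S) (card {c. c < n \<and> own c \<noteq> 0})) n K"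
      and outE: "\<forall>u<n. \<forall>v<n. s ''outE'' (u * n + v) \<noteq> 0 \<longleftrightarrow> u \<in> S \<union> K \<and> v \<in> S \<union> K \<and> E u v"
      unfolding kernelized_def by - (elim conjE, assumption)+
    let ?H = "output_graph n s"
    have SK: "S \<union> K \<subseteq> {..<n}" using S_sub filled by (auto simp: filled_def)
    have H_V: "pverts ?H = S \<union> K" using out SK by (auto simp: output_graph_def outputs_def split: if_splits)
    \<comment> \<open>This is the form required by \<open>has_cycle_cover_iff_coverable\<close>; as
      \<open>E\<close> is the arc relation of \<open>G\<close>, it also yields inducedness.\<close>
    have H_E: "parcs ?H = {(u, v). u \<in> pverts ?H \<and> v \<in> pverts ?H \<and> E u v}"
    proof -
      have "parcs ?H = {(u, v). u < n \<and> v < n \<and> s ''outE'' (u * n + v) \<noteq> 0}"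
        by (simp add: output_graph_def)
      also have "\<dots> = {(u, v). u \<in> S \<union> K \<and> v \<in> S \<union> K \<and> E u v}"
        using outE SK by blast
      finally show ?thesis by (simp only: H_V)
    qed
    have G_E: "parcs G = {(u, v). u \<in> pverts G \<and> v \<in> pverts G \<and> E u v}"
      using G.in_arcsD1 G.in_arcsD2 by (auto simp: E_def)
    have SC: "S \<union> ({..<n} - S) = {..<n}" using S_sub by auto
    have "wf_digraph (with_proj ?H)"
      by unfold_locales (auto simp: H_E)
    then have "subgraph (with_proj ?H) (with_proj G)"
      using H_V SK V G.wf_digraph
      by (auto simp: subgraph_def compatible_def H_E E_def)
    then have "induced_subgraph (with_proj ?H) (with_proj G)"
      by (auto simp: induced_subgraph_def H_E E_def)
    moreover have "has_cycle_cover_of_size_le (with_proj G) r \<longleftrightarrow>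
        has_cycle_cover_of_size_le (with_proj ?H) r" if r: "1 \<le> r" for r
      using kernel_correct(1)[OF split good filled r] has_cycle_cover_iff_coverable[OF G_E, of r]
        has_cycle_cover_iff_coverable[OF H_E, of r] SK H_V V SC
      by simp
    moreover have "card (pverts ?H) \<le> 3 * card S"
      using kernel_correct(2)[OF split good filled] H_V by simp
    ultimately show "\<exists>t s. exec kernelize (input_store n G S) t s \<and> t \<le> poly p n \<and>
        induced_subgraph (with_proj (output_graph n s)) (with_proj G) \<and>
        card (pverts (output_graph n s)) \<le> 3 * card S \<and>
        (\<forall>r::nat. 1 \<le> r \<longrightarrow>
          (has_cycle_cover_of_size_le (with_proj G) r \<longleftrightarrow>
           has_cycle_cover_of_size_le (with_proj (output_graph n s)) r))"
      using run p[of n] by auto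
  qed
qed

end
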